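(* For even $n\ge 2$, there are exactly $\binom{n}{n/2}$ centrally symmetric matchings in $\mathcal{M}_n$, and the centrally symmetric matchings form connected components of $\mathcal{H}_n$ (each such component contains only centrally symmetric matchings) that are trees. There are exactly $C_{n/2}$ such components, and each of them contains exactly $n/2+1$ matchings. Every matching that is not centrally symmetric lies in a connected component of $\mathcal{H}_n$ that is not a tree.
   Context: Fix an integer $n\ge 2$ and place $2n$ points equidistantly on the unit circle. $\mathcal{M}_n$ is the set of all non-crossing straight-line perfect matchings on these $2n$ points (each has $n$ edges). For $M\in\mathcal{M}_n$, two edges $e,f\in M$ span an empty quadrilateral if the convex hull of $e$ and $f$ contains no other edge of $M$; replacing $e,f$ by the other two edges of this quadrilateral yields another matching of $\mathcal{M}_n$ (a flip). A flip is centered if the closed quadrilateral contains the center of the circle (possibly on its boundary). $\mathcal{H}_n$ is the graph with vertex set $\mathcal{M}_n$ and an edge between two matchings if they differ by a centered flip. A matching is centrally symmetric if it is invariant under point reflection at the circle center. $C_k=\frac{1}{k+1}\binom{2k}{k}$ is the $k$th Catalan number. *)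

theory Defs
  imports "HOL-Analysis.Analysis"
begin

section \<open>Non-crossing perfect matchings of points on the unit circle\<close>

text \<open>The plane is the complex plane, with the circle center at \<open>0\<close>. A straight-line edge is
  represented by the set of its two endpoints; as a segment it is the convex hull of this set.\<close>

definition circle_points :: "nat \<Rightarrow> complex set" where
  "circle_points n = (\<lambda>k. cis (2 * pi * real k / real (2 * n))) ` {..<2 * n}"

definition perfect_matching :: "'a set \<Rightarrow> 'a set set \<Rightarrow> bool" where
  "perfect_matching P M \<longleftrightarrow> partition_on P M \<and> (\<forall>e\<in>M. card e = 2)"

definition non_crossing :: "complex set set \<Rightarrow> bool" where
  "non_crossing M \<longleftrightarrow> pairwise (\<lambda>e f. disjnt (convex hull e) (convex hull f)) M"

definition matchings :: "nat \<Rightarrow> complex set set set" where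
  "matchings n = {M. perfect_matching (circle_points n) M \<and> non_crossing M}"

definition centrally_symmetric :: "complex set set \<Rightarrow> bool" where
  "centrally_symmetric M \<longleftrightarrow> (\<lambda>e. uminus ` e) ` M = M"


section \<open>Centered flips\<close>

text \<open>All endpoints lie on a circle, so no further edge of \<open>M\<close> can lie entirely inside the
  quadrilateral; emptiness means that no further edge of \<open>M\<close> runs through it.\<close>

definition empty_quadrilateral :: "complex set set \<Rightarrow> complex set \<Rightarrow> complex set \<Rightarrow> bool" where
  "empty_quadrilateral M e f \<longleftrightarrow>
     (\<forall>g\<in>M - {e, f}. disjnt (convex hull g) (convex hull (e \<union> f)))"

definition quadrilateral_edges :: "complex set \<Rightarrow> complex set \<Rightarrow> complex set set" where
  "quadrilateral_edges e f =
     {g. g \<subseteq> e \<union> f \<and> card g = 2 \<and> (convex hull g) edge_of (convex hull (e \<union> f))}"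

definition centered_flip :: "complex set set \<Rightarrow> complex set set \<Rightarrow> bool" where
  "centered_flip M M' \<longleftrightarrow>
     (\<exists>e\<in>M. \<exists>f\<in>M. e \<noteq> f \<and> empty_quadrilateral M e f \<and> 0 \<in> convex hull (e \<union> f) \<and>
        M' = (M - {e, f}) \<union> (quadrilateral_edges e f - {e, f}))"


section \<open>Undirected graphs\<close>

text \<open>A simple graph is given by its vertex set \<open>V\<close> and its set \<open>E\<close> of two-element edges.\<close>

definition graph_component :: "'v set \<Rightarrow> 'v set set \<Rightarrow> 'v \<Rightarrow> 'v set" where
  "graph_component V E v = {u \<in> V. (v, u) \<in> {(x, y). x \<in> V \<and> y \<in> V \<and> {x, y} \<in> E}\<^sup>*}"

definition graph_components :: "'v set \<Rightarrow> 'v set set \<Rightarrow> 'v set set" where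
  "graph_components V E = graph_component V E ` V"

definition induced_edges :: "'v set set \<Rightarrow> 'v set \<Rightarrow> 'v set set" where
  "induced_edges E K = {e \<in> E. e \<subseteq> K}"

definition graph_connected :: "'v set \<Rightarrow> 'v set set \<Rightarrow> bool" where
  "graph_connected V E \<longleftrightarrow> V \<noteq> {} \<and> (\<forall>v\<in>V. graph_component V E v = V)"

definition graph_cycle :: "'v set \<Rightarrow> 'v set set \<Rightarrow> 'v list \<Rightarrow> bool" where
  "graph_cycle V E p \<longleftrightarrow> 3 \<le> length p \<and> distinct p \<and> set p \<subseteq> V \<and>
     (\<forall>i. Suc i < length p \<longrightarrow> {p ! i, p ! Suc i} \<in> E) \<and> {last p, hd p} \<in> E"

definition graph_tree :: "'v set \<Rightarrow> 'v set set \<Rightarrow> bool" where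
  "graph_tree V E \<longleftrightarrow> graph_connected V E \<and> (\<nexists>p. graph_cycle V E p)"


section \<open>The centered flip graph and Catalan numbers\<close>

definition H_verts :: "nat \<Rightarrow> complex set set set" where
  "H_verts n = matchings n"

definition H_edges :: "nat \<Rightarrow> complex set set set set" where
  "H_edges n = {{M, M'} | M M'. M \<in> matchings n \<and> M' \<in> matchings n \<and> centered_flip M M'}"

definition H_components :: "nat \<Rightarrow> complex set set set set" where
  "H_components n = graph_components (H_verts n) (H_edges n)"

definition catalan :: "nat \<Rightarrow> real" where
  "catalan k = 1 / (real k + 1) * real ((2 * k) choose k)"

end

theory Submission
  imports Defs
begin

text \<open>No edge is a diameter when \<open>n\<close> is even, so every edge cuts off a unique arc shorter than a half
  circle, and a matching lifts to a \<open>2n\<close>-periodic non-crossing involution of the integers all of whose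
  arcs are shorter than \<open>n\<close>. A centered flip turns two maximal arcs \<open>(a, b)\<close>, \<open>(c, d)\<close> into \<open>(b, c)\<close>,
  \<open>(d, a + 2n)\<close>. Maximal arcs are the edges of the face containing the center.

  A symmetric matching only admits flips of antipodal pairs, and these preserve its projection to a
  non-crossing matching of \<open>n\<close> points on the quotient circle. The flips move the center of rotation from one
  face of this matching to an adjacent one, so the component is its dual tree, with \<open>n/2 + 1\<close> vertices.
  Symmetric matchings correspond to balanced cyclic bracket words of length \<open>n\<close>, and the number of
  components follows by division.

  A matching whose central face is asymmetric has two flips leading to matchings of the same kind, which
  yields a cycle. An asymmetric matching with a symmetric central face reaches such a matching by antipodal
  flips that bring an edge without antipodal partner to the central face.\<close>

section \<open>Points on the circle and their convex hulls\<close>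

text \<open>The parity of \<open>n\<close> removes the degenerate cases. A diameter would leave
  \<open>n - 1\<close> points on either side, an odd number that cannot be matched; so the center
  never lies on an edge. The same parity keeps the new edges of a flip from being diameters, so all
  four gaps are strictly shorter than a half circle. Lifting replaces cyclic order by linear order:
  nesting and crossing become inequalities, at the price of carrying the period \<open>2 * N\<close>
  along. The dual tree is never constructed. Instead every symmetric lift carries a natural number,
  its \<open>rank\<close>; adjacent lifts differ by one in rank and at most one neighbour is lower,
  which excludes cycles. The size of a component comes from the \<open>n / 2\<close> arcs of the
  quotient matching: each vertex other than the root is determined by the arc turned last on the way
  to it. The obstacle in the asymmetric case is that an asymmetric matching may still have a
  symmetric central face. The cycle is therefore sought among the matchings with an asymmetric
  central face, not among all asymmetric ones.\<close>

lemma even_card_fixpoint_free_involution: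
  fixes f :: "'a::linorder \<Rightarrow> 'a"
  assumes "finite S" and maps: "\<And>x. x \<in> S \<Longrightarrow> f x \<in> S"
    and inv: "\<And>x. x \<in> S \<Longrightarrow> f (f x) = x" and free: "\<And>x. x \<in> S \<Longrightarrow> f x \<noteq> x"
  shows "even (card S)"
proof -
  have "bij_betw f {x\<in>S. x < f x} {x\<in>S. f x < x}"
    by (rule bij_betw_byWitness[where f' = f]) (auto simp: maps inv)
  then have "card {x\<in>S. x < f x} = card {x\<in>S. f x < x}"
    by (rule bij_betw_same_card)
  moreover have "S = {x\<in>S. x < f x} \<union> {x\<in>S. f x < x}"
    using free by (force simp: neq_iff)
  then have "card S = card {x\<in>S. x < f x} + card {x\<in>S. f x < x}"
    using \<open>finite S\<close> by (subst card_Un_disjoint[symmetric]) auto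
  ultimately show ?thesis by simp
qed

section \<open>Integer coordinates on the circle\<close>

locale even_circle =
  fixes n :: nat
  assumes n_ge_2: "n \<ge> 2" and even_n: "even n"
begin

abbreviation N :: int where "N \<equiv> int n"

text \<open>All integers serve as indices, not just residues, so that an arc of the circle is an
  integer interval and a window of length \<open>2 * N\<close> may start anywhere.\<close>

definition z :: "int \<Rightarrow> complex" where
  "z k = cis (pi * real_of_int k / real n)"

lemma N_ge_2: "N \<ge> 2" and N_pos: "N > 0"
  using n_ge_2 by auto

lemma z_eq_iff: "z k = z l \<longleftrightarrow> 2 * N dvd k - l"
proof -
  have "z k = z l \<longleftrightarrow> z k / z l = 1"
    by (simp add: z_def)
  also have "z k / z l = cis (pi * real_of_int (k - l) / real n)"
    by (simp add: z_def cis_divide diff_divide_distrib right_diff_distrib)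
  also have "\<dots> = 1 \<longleftrightarrow> (\<exists>j::int. pi * real_of_int (k - l) / real n = of_int (2 * j) * pi)"
    by (subst cis_conv_exp) (simp add: exp_eq_1)
  also have "\<dots> \<longleftrightarrow> (\<exists>j::int. real_of_int (k - l) = real_of_int (2 * N * j))"
  proof -
    have "pi * x / real n = of_int (2 * j) * pi \<longleftrightarrow> x = real_of_int (2 * N * j)" for x and j :: int
      using n_ge_2 by (simp add: field_simps)
    then show ?thesis by simp
  qed
  also have "\<dots> \<longleftrightarrow> 2 * N dvd k - l"
    by (metis dvd_def of_int_eq_iff)
  finally show ?thesis .
qed

lemma z_period: "z (k + 2 * N * j) = z k"
  by (simp add: z_eq_iff)

lemma z_eq_imp_eq: "z k = z l \<Longrightarrow> \<bar>k - l\<bar> < 2 * N \<Longrightarrow> k = l"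
  unfolding z_eq_iff by (metis dvd_imp_le_int abs_of_nat abs_mult abs_numeral eq_iff_diff_eq_0 linorder_not_less)

lemma z_neq_window: "k < l \<Longrightarrow> l < k + 2 * N \<Longrightarrow> z k \<noteq> z l"
  using z_eq_imp_eq[of k l] by auto

lemma uminus_z: "- z k = z (k + N)"
proof -
  have "z (k + N) = cis (pi * real_of_int k / real n + pi)"
    using n_ge_2 by (simp add: z_def field_simps)
  then show ?thesis by (simp add: z_def flip: cis_mult)
qed

lemma z_surj_window: "\<exists>k\<in>{x..<x + 2 * N}. z k = z l"
proof
  show "x + (l - x) mod (2 * N) \<in> {x..<x + 2 * N}"
    using N_pos by simp
  show "z (x + (l - x) mod (2 * N)) = z l"
    by (simp add: z_eq_iff mod_eq_dvd_iff[symmetric] mod_simps)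
qed

lemma circle_points_eq: "circle_points n = range z"
proof -
  have "circle_points n = z ` {0..<2 * N}"
  proof -
    have "{0..<2 * N} = int ` {..<2 * n}"
      by (auto simp: image_iff intro!: bexI[of _ "nat _"])
    then show ?thesis
      by (simp add: circle_points_def z_def image_image)
  qed
  also have "\<dots> = range z"
    using z_surj_window[of 0] by (auto simp: image_iff) metis
  finally show ?thesis .
qed

lemma z_mem_image: "k \<in> I \<Longrightarrow> z k \<in> z ` I" and z_mem_image_shift: "k + 2 * N \<in> I \<Longrightarrow> z k \<in> z ` I"
  using z_period[of k 1] by (auto simp: image_iff) metis

text \<open>Projecting to the bisector of the arc from \<open>z x\<close> to \<open>z y\<close> separates it from the rest.\<close>

lemma arc_functional:
  assumes "x \<le> y" "y < x + 2 * N"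
  obtains v :: complex and t where "v \<bullet> z x = t" "v \<bullet> z y = t"
    "\<And>k. x \<le> k \<Longrightarrow> k \<le> y \<Longrightarrow> t \<le> v \<bullet> z k"
    "\<And>k. y < k \<Longrightarrow> k < x + 2 * N \<Longrightarrow> v \<bullet> z k < t"
    "y < x + N \<Longrightarrow> 0 < t"
proof -
  \<comment> \<open>Midpoint and half-length of the arc in index units. The functional projects to
    the direction of the midpoint, so its value at \<open>z k\<close> depends only on the distance
    of \<open>k\<close> from \<open>m\<close>.\<close>
  define m where "m = real_of_int (x + y) / 2"
  define r where "r = real_of_int (y - x) / 2"
  define v where "v = cis (pi * m / real n)"
  define g where "g = (\<lambda>s. cos (pi * s / real n))"
  have n0: "real n > 0" using n_ge_2 by simp
  have inner: "v \<bullet> z k = g (k - m)" for k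
    unfolding v_def z_def g_def
    by (simp add: inner_complex_def diff_divide_distrib right_diff_distrib cos_diff)
  have even: "g (-s) = g s" for s
    by (simp add: g_def)
  have anti: "g s' \<le> g s" if "0 \<le> s" "s \<le> s'" "s' \<le> real n" for s s'
    unfolding g_def using that n0 by (intro cos_monotone_0_pi_le) (auto simp: field_simps)
  have anti_less: "g s' < g s" if "0 \<le> s" "s < s'" "s' \<le> real n" for s s'
    unfolding g_def using that n0 by (intro cos_monotone_0_pi) (auto simp: field_simps)
  \<comment> \<open>The cosine decreases only up to the antipode of \<open>m\<close>. Positions
    beyond it are reflected back, and \<open>k < x + 2 * N\<close> keeps the reflected distance
    above \<open>r\<close>.\<close>
  have refl: "g (2 * real n - s) = g s" for s
  proof -
    have "pi * (2 * real n - s) / real n = 2 * pi - pi * s / real n"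
      using n0 by (simp add: field_simps)
    then show ?thesis by (simp add: g_def cos_diff)
  qed
  have r: "0 \<le> r" "r < real n"
    using assms unfolding r_def by auto
  show ?thesis
  proof (rule that[of v "g r"])
    show "v \<bullet> z x = g r"
    proof -
      have "x - m = - r" by (simp add: m_def r_def field_simps)
      then show ?thesis unfolding inner by (simp add: even)
    qed
    show "v \<bullet> z y = g r"
      unfolding inner by (simp add: m_def r_def field_simps)
  next
    fix k assume k: "x \<le> k" "k \<le> y"
    have "g (k - m) = g \<bar>k - m\<bar>"
      by (cases "k - m \<ge> 0") (use even[of "k - m"] in auto)
    moreover have "\<bar>k - m\<bar> \<le> r"
      using k unfolding m_def r_def by (simp add: abs_le_iff field_simps)
    ultimately show "g r \<le> v \<bullet> z k"
      unfolding inner using anti[of "\<bar>k - m\<bar>" r] r by auto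
  next
    fix k assume k: "y < k" "k < x + 2 * N"
    have "real_of_int k < real_of_int (x + 2 * N)"
      using k by (simp only: of_int_less_iff)
    then have *: "k - m > r" "2 * real n - (k - m) > r"
      using k unfolding m_def r_def by (auto simp: field_simps)
    show "v \<bullet> z k < g r"
    proof (cases "k - m \<le> real n")
      case True
      then show ?thesis unfolding inner using anti_less[of r "k - m"] * r by simp
    next
      case False
      then show ?thesis unfolding inner
        using anti_less[of r "2 * real n - (k - m)"] * r by (simp add: refl)
    qed
  next
    assume "y < x + N"
    then have "r / real n < 1 / 2"
      using n0 unfolding r_def by (simp add: field_simps)
    then have "pi * (r / real n) < pi * (1 / 2)"
      by (intro mult_strict_left_mono) auto
    then have "pi * r / real n < pi / 2" by simp
    moreover have "pi * r / real n \<ge> 0" using r by simp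
    ultimately show "0 < g r"
      unfolding g_def by (intro cos_gt_zero_pi) linarith+
  qed
qed

section \<open>Separation of arcs and position of the center\<close>

lemma arc_hull_disjoint:
  assumes "x \<le> y" "y < x + 2 * N" "A \<subseteq> z ` {x..y}" "B \<subseteq> z ` {y<..<x + 2 * N}"
  shows "convex hull A \<inter> convex hull B = {}"
proof -
  obtain v t where vt: "\<And>k. x \<le> k \<Longrightarrow> k \<le> y \<Longrightarrow> t \<le> v \<bullet> z k"
    "\<And>k. y < k \<Longrightarrow> k < x + 2 * N \<Longrightarrow> v \<bullet> z k < t"
    using arc_functional[OF assms(1,2)] by metis
  have "convex hull A \<subseteq> {w. v \<bullet> w \<ge> t}"
    using assms(3) vt(1) by (intro hull_minimal convex_halfspace_ge) auto
  moreover have "convex hull B \<subseteq> {w. v \<bullet> w < t}"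
    using assms(4) vt(2) by (intro hull_minimal convex_halfspace_lt) auto
  ultimately show ?thesis by fastforce
qed

text \<open>On an arc shorter than a half circle the functional is bounded below by a positive
  \<open>t\<close>, while it vanishes at the center. This is what rules out quadrilaterals that miss
  the center.\<close>

lemma zero_notin_arc_hull:
  assumes "x \<le> y" "y < x + N" "A \<subseteq> z ` {x..y}"
  shows "0 \<notin> convex hull A"
proof -
  have "y < x + 2 * N" using assms by simp
  then obtain v t where vt: "\<And>k. x \<le> k \<Longrightarrow> k \<le> y \<Longrightarrow> t \<le> v \<bullet> z k" "t > 0"
    using arc_functional[OF assms(1)] assms(2) by metis
  have "convex hull A \<subseteq> {w. v \<bullet> w \<ge> t}"
    using assms(3) vt(1) by (intro hull_minimal convex_halfspace_ge) auto
  then show ?thesis using vt(2) by fastforce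
qed

text \<open>The barycentric coordinates of a circumcenter are proportional to the sines of the
  opposite central angles. No gap exceeds a half circle, so all three are nonnegative; a center on a
  side is included.\<close>

lemma zero_in_triangle:
  assumes "a < b" "b < c" "b \<le> a + N" "c \<le> b + N" "a + N \<le> c" "c < a + 2 * N"
  shows "0 \<in> convex hull {z a, z b, z c}"
proof -
  define \<theta> where "\<theta> k = pi * real_of_int k / real n" for k
  have n0: "real n > 0" using n_ge_2 by simp
  have diff: "\<theta> k - \<theta> l = pi * real_of_int (k - l) / real n" for k l
    by (simp add: \<theta>_def diff_divide_distrib right_diff_distrib)
  have sin_nonneg: "sin (\<theta> k - \<theta> l) \<ge> 0" if "l \<le> k" "k \<le> l + N" for k l
  proof -
    have "real_of_int (k - l) / real n \<le> 1" using that n0 by (simp add: divide_le_eq)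
    then have "pi * (real_of_int (k - l) / real n) \<le> pi * 1"
      by (intro mult_left_mono) auto
    then show ?thesis unfolding diff using that n0 by (intro sin_ge_zero) auto
  qed
  have sin_pos: "sin (\<theta> k - \<theta> l) > 0" if "l < k" "k < l + N" for k l
  proof -
    have "real_of_int (k - l) / real n < 1" using that n0 by (simp add: divide_less_eq)
    then have "pi * (real_of_int (k - l) / real n) < pi * 1"
      by (intro mult_strict_left_mono) auto
    then show ?thesis unfolding diff using that n0 by (intro sin_gt_zero) auto
  qed
  define u v w where "u = sin (\<theta> c - \<theta> b)" and "v = sin (\<theta> a - \<theta> c)"
    and "w = sin (\<theta> b - \<theta> a)"
  \<comment> \<open>As first written the angle is negative; a full turn moves it into the range
    where the sine is nonnegative.\<close>
  have v_alt: "v = sin (\<theta> (a + 2 * N) - \<theta> c)"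
  proof -
    have "\<theta> (a + 2 * N) - \<theta> c = (\<theta> a - \<theta> c) + 2 * pi"
      using n0 by (simp add: \<theta>_def field_simps)
    then show ?thesis by (simp only: v_def sin_periodic)
  qed
  have nonneg: "u \<ge> 0" "v \<ge> 0" "w \<ge> 0"
    using assms sin_nonneg unfolding u_def v_alt w_def by auto
  \<comment> \<open>Only \<open>b = a + N\<close> makes \<open>w\<close> vanish, and then
    \<open>c - b\<close> lies strictly between 0 and \<open>N\<close>.\<close>
  have "u + v + w > 0"
  proof (cases "b = a + N")
    case False
    then have "w > 0"
      unfolding w_def using assms False by (intro sin_pos) auto
    then show ?thesis using nonneg by simp
  next
    case True
    then have "u > 0"
      unfolding u_def using assms True N_pos by (intro sin_pos) auto
    then show ?thesis using nonneg by simp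
  qed
  have zc: "z k = Complex (cos (\<theta> k)) (sin (\<theta> k))" for k
    by (simp add: z_def \<theta>_def cis.ctr)
  have zero: "u *\<^sub>R z a + v *\<^sub>R z b + w *\<^sub>R z c = 0"
    unfolding zc u_def v_def w_def
    by (simp add: complex_eq_iff sin_diff algebra_simps)
  define s where "s = u + v + w"
  have "(u / s) *\<^sub>R z a + (v / s) *\<^sub>R z b + (w / s) *\<^sub>R z c = (1 / s) *\<^sub>R (u *\<^sub>R z a + v *\<^sub>R z b + w *\<^sub>R z c)"
    by (simp add: scaleR_add_right)
  then have "(u / s) *\<^sub>R z a + (v / s) *\<^sub>R z b + (w / s) *\<^sub>R z c = 0"
    unfolding zero by simp
  moreover have "u / s + v / s + w / s = 1"
    using \<open>u + v + w > 0\<close> by (simp add: s_def add_divide_distrib[symmetric])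
  ultimately show ?thesis
    unfolding convex_hull_3 using nonneg \<open>u + v + w > 0\<close>
    by (intro CollectI exI[of _ "u / s"] exI[of _ "v / s"] exI[of _ "w / s"]) (auto simp: s_def)
qed

text \<open>The diagonal from \<open>z a\<close> to \<open>z c\<close> cuts the quadrilateral into
  two triangles; which of them contains the center depends on whether the arc from \<open>a\<close>
  to \<open>c\<close> reaches a half circle.\<close>

lemma zero_in_quadrilateral:
  assumes "a < b" "b < c" "c < d" "b \<le> a + N" "c \<le> b + N" "d \<le> c + N" "a + N \<le> d" "d < a + 2 * N"
  shows "0 \<in> convex hull {z a, z b, z c, z d}"
proof (cases "a + N \<le> c")
  case True
  then have "0 \<in> convex hull {z a, z b, z c}"
    using assms by (intro zero_in_triangle) auto
  then show ?thesis by (meson hull_mono subsetD insert_mono subset_insertI empty_subsetI)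
next
  case False
  then have "0 \<in> convex hull {z a, z c, z d}"
    using assms by (intro zero_in_triangle) auto
  then show ?thesis using hull_mono[of "{z a, z c, z d}" "{z a, z b, z c, z d}" convex] by blast
qed

text \<open>By Radon's theorem some partition of the four points has intersecting hulls, and
  \<open>arc_hull_disjoint\<close> rules out every other one.\<close>

lemma crossing_chords_meet:
  assumes "a < c" "c < b" "b < d" "d < a + 2 * N"
  shows "convex hull {z a, z b} \<inter> convex hull {z c, z d} \<noteq> {}"
proof -
  have ne: "z a \<noteq> z b" "z a \<noteq> z c" "z a \<noteq> z d" "z c \<noteq> z b" "z b \<noteq> z d" "z c \<noteq> z d"
    using assms by (simp_all add: z_neq_window)
  define S where "S = {z a, z b, z c, z d}"
  have "card S = 4" using ne by (simp add: S_def)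
  then have "affine_dependent S"
    by (intro affine_dependent_biggerset) (auto simp: S_def)
  then obtain A B where AB: "A \<inter> B = {}" "A \<union> B = S" "convex hull A \<inter> convex hull B \<noteq> {}"
    using Radon_partition[of S] unfolding S_def by auto
  have a': "z a = z (a + 2 * N)" and b': "z b = z (b + 2 * N)" and c': "z c = z (c + 2 * N)"
    using z_period[of _ 1] by auto
  have key: "Y = {z c, z d} \<and> X = {z a, z b}"
    if XY: "X \<inter> Y = {}" "X \<union> Y = S" "convex hull X \<inter> convex hull Y \<noteq> {}" "z a \<in> X" for X Y
  proof -
    have sep: False if "x \<le> y" "y < x + 2 * N" "Y \<subseteq> z ` {x..y}" "X \<subseteq> z ` {y<..<x + 2 * N}" for x y
      using arc_hull_disjoint[OF that] XY(3) by auto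
    have "Y \<subseteq> {z b, z c, z d}"
      using XY ne unfolding S_def by blast
    then have "Y \<in> Pow {z b, z c, z d}" by simp
    then have "Y \<in> {{}, {z b}, {z c}, {z d}, {z b, z c}, {z b, z d}, {z c, z d}, {z b, z c, z d}}"
      unfolding Pow_insert Pow_empty by auto
    moreover have X: "X = S - Y" using XY by blast
    moreover have "Y \<noteq> {}" using XY(3) by auto
    moreover have "Y \<noteq> {z b}"
    proof
      assume "Y = {z b}"
      moreover from this have "X = {z a, z c, z d}" using X ne unfolding S_def by auto
      ultimately show False
        using sep[of b b] assms by (simp add: z_mem_image z_mem_image_shift)
    qed
    moreover have "Y \<noteq> {z c}"
    proof
      assume "Y = {z c}"
      moreover from this have "X = {z a, z b, z d}" using X ne unfolding S_def by auto
      ultimately show False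
        using sep[of c c] assms by (simp add: z_mem_image z_mem_image_shift)
    qed
    moreover have "Y \<noteq> {z d}"
    proof
      assume "Y = {z d}"
      moreover from this have "X = {z a, z b, z c}" using X ne unfolding S_def by auto
      ultimately show False
        using sep[of d d] assms by (simp add: z_mem_image z_mem_image_shift)
    qed
    moreover have "Y \<noteq> {z b, z c}"
    proof
      assume "Y = {z b, z c}"
      moreover from this have "X = {z a, z d}" using X ne unfolding S_def by auto
      ultimately show False
        using sep[of c b] assms by (simp add: z_mem_image z_mem_image_shift)
    qed
    moreover have "Y \<noteq> {z b, z d}"
    proof
      assume "Y = {z b, z d}"
      moreover from this have "X = {z a, z c}" using X ne unfolding S_def by auto
      ultimately show False
        using sep[of b d] assms by (simp add: z_mem_image z_mem_image_shift)
    qed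
    moreover have "Y \<noteq> {z b, z c, z d}"
    proof
      assume "Y = {z b, z c, z d}"
      moreover from this have "X = {z a}" using X ne unfolding S_def by auto
      ultimately show False
        using sep[of c d] assms by (simp add: z_mem_image z_mem_image_shift)
    qed
    ultimately have "Y = {z c, z d}" by blast
    then show ?thesis using X ne unfolding S_def by auto
  qed
  show ?thesis
  proof (cases "z a \<in> A")
    case True
    then show ?thesis using key[of A B] AB by auto
  next
    case False
    then have "z a \<in> B" using AB unfolding S_def by blast
    then show ?thesis using key[of B A] AB by (simp add: Int_commute Un_commute)
  qed
qed

text \<open>This turns the geometric condition into a comparison of indices: chords with both ends
  on one side are separated by an arc, and otherwise they interlace and meet.\<close>

lemma chords_disjoint_iff:
  assumes "a < b" "b < a + 2 * N" "a < c" "c < a + 2 * N" "a < d" "d < a + 2 * N" "c \<noteq> b" "d \<noteq> b"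
  shows "disjnt (convex hull {z a, z b}) (convex hull {z c, z d}) \<longleftrightarrow> (c < b \<longleftrightarrow> d < b)"
proof -
  have a': "z a = z (a + 2 * N)"
    using z_period[of _ 1] by auto
  consider "c < b" "d < b" | "c < b" "b < d" | "b < c" "d < b" | "b < c" "b < d"
    using assms by linarith
  then show ?thesis
  proof cases
    case 1
    then have "convex hull {z c, z d} \<inter> convex hull {z a, z b} = {}"
      using assms a' by (intro arc_hull_disjoint[of "a + 1" "b - 1"]) auto
    then show ?thesis using 1 by (auto simp: disjnt_def)
  next
    case 2
    then show ?thesis using crossing_chords_meet[of a c b d] assms by (auto simp: disjnt_def)
  next
    case 3
    then show ?thesis using crossing_chords_meet[of a d b c] assms
      by (auto simp: disjnt_def insert_commute)
  next
    case 4
    then have "convex hull {z a, z b} \<inter> convex hull {z c, z d} = {}"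
      using assms by (intro arc_hull_disjoint[of a b]) auto
    then show ?thesis using 4 by (auto simp: disjnt_def)
  qed
qed

text \<open>The arc functional is constant on the line through \<open>z x\<close> and
  \<open>z y\<close> and strictly smaller on \<open>T\<close>, so this line supports the
  hull.\<close>

lemma side_edge_of:
  assumes "x < y" "y < x + 2 * N" "T \<subseteq> z ` {y<..<x + 2 * N}" "finite T"
  shows "(convex hull {z x, z y}) edge_of (convex hull ({z x, z y} \<union> T))"
proof -
  have ne: "z x \<noteq> z y"
    using assms z_eq_imp_eq[of x y] by auto
  obtain v t where vt: "v \<bullet> z x = t" "v \<bullet> z y = t"
    "\<And>k. y < k \<Longrightarrow> k < x + 2 * N \<Longrightarrow> v \<bullet> z k < t"
    using arc_functional[of x y] assms by (metis less_imp_le)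
  have "affine hull {z x, z y} \<subseteq> {w. v \<bullet> w = t}"
    using vt by (intro hull_minimal affine_hyperplane) auto
  moreover have "convex hull (({z x, z y} \<union> T) - {z x, z y}) \<subseteq> {w. v \<bullet> w < t}"
    using assms(3) vt(3) by (intro hull_minimal convex_halfspace_lt) auto
  ultimately have "(convex hull {z x, z y}) face_of (convex hull ({z x, z y} \<union> T))"
    using \<open>finite T\<close> by (intro face_of_convex_hulls) fastforce+
  then show ?thesis
    using ne by (simp add: edge_of_def aff_dim_convex_hull aff_dim_2)
qed

text \<open>A face that contains an interior point of a segment contains its ends. Here the segment
  is the other diagonal and the point is where the two diagonals cross.\<close>

lemma diagonal_not_edge_of:
  assumes "a < c" "c < b" "b < d" "d < a + 2 * N" "z c \<in> S" "z d \<in> S"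
  shows "\<not> (convex hull {z a, z b}) edge_of (convex hull S)"
proof
  assume "(convex hull {z a, z b}) edge_of (convex hull S)"
  then have face: "(convex hull {z a, z b}) face_of (convex hull S)"
    by (simp add: edge_of_def)
  have a': "z a = z (a + 2 * N)" and b': "z b = z (b + 2 * N)"
    using z_period[of _ 1] by auto
  obtain w where w: "w \<in> convex hull {z a, z b}" "w \<in> convex hull {z c, z d}"
    using crossing_chords_meet[OF assms(1-4)] by auto
  have c: "z c \<notin> convex hull {z a, z b}"
    using arc_hull_disjoint[of c c "{z c}" "{z a, z b}"] a' assms by auto
  have d: "z d \<notin> convex hull {z a, z b}"
    using arc_hull_disjoint[of d d "{z d}" "{z a, z b}"] a' b' assms by auto
  have "w \<in> open_segment (z c) (z d)"
    using w c d by (auto simp: open_segment_def segment_convex_hull)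
  moreover have "z c \<in> convex hull S" "z d \<in> convex hull S"
    using assms by (auto intro: hull_inc)
  ultimately have "z c \<in> convex hull {z a, z b}"
    using face w(1) unfolding face_of_def by blast
  then show False using c by simp
qed

lemma quadrilateral_edges_z:
  assumes "a < b" "b < c" "c < d" "d < a + 2 * N"
  shows "quadrilateral_edges {z a, z b} {z c, z d} = {{z a, z b}, {z b, z c}, {z c, z d}, {z d, z a}}"
proof -
  have ne: "z a \<noteq> z b" "z a \<noteq> z c" "z a \<noteq> z d" "z b \<noteq> z c" "z b \<noteq> z d" "z c \<noteq> z d"
    using assms by (simp_all add: z_neq_window)
  have a': "z a = z (a + 2 * N)" and b': "z b = z (b + 2 * N)" and c': "z c = z (c + 2 * N)"
    using z_period[of _ 1] by auto
  define S where "S = {z a, z b} \<union> {z c, z d}"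
  have pairs: "g \<in> {{z a, z b}, {z b, z c}, {z c, z d}, {z d, z a}, {z a, z c}, {z b, z d}}"
    if g: "g \<subseteq> S" "card g = 2" for g
  proof -
    obtain x y where "g = {x, y}" "x \<noteq> y" using g(2) by (auto simp: card_2_iff)
    then show ?thesis using g(1) unfolding S_def by (auto simp: insert_commute)
  qed
  \<comment> \<open>Each side needs a window in which the other two vertices come after it, hence
    the representatives shifted by \<open>2 * N\<close>.\<close>
  have ab: "(convex hull {z a, z b}) edge_of (convex hull S)"
    using side_edge_of[of a b "{z c, z d}"] assms by (simp add: S_def)
  have bc: "(convex hull {z b, z c}) edge_of (convex hull S)"
    using side_edge_of[of b c "{z d, z a}"] assms a' by (simp add: S_def insert_commute)
  have cd: "(convex hull {z c, z d}) edge_of (convex hull S)"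
    using side_edge_of[of c d "{z a, z b}"] assms a' b' by (simp add: S_def insert_commute)
  have da: "(convex hull {z d, z a}) edge_of (convex hull S)"
    using side_edge_of[of d "a + 2 * N" "{z b, z c}"] assms a' b' c' by (simp add: S_def insert_commute)
  have "\<not> (convex hull {z a, z c}) edge_of (convex hull S)"
    using diagonal_not_edge_of[of a b c d S] assms by (simp add: S_def)
  moreover have "\<not> (convex hull {z b, z d}) edge_of (convex hull S)"
    using diagonal_not_edge_of[of b c d "a + 2 * N" S] assms a' by (simp add: S_def)
  ultimately have "quadrilateral_edges {z a, z b} {z c, z d} \<subseteq> {{z a, z b}, {z b, z c}, {z c, z d}, {z d, z a}}"
    unfolding quadrilateral_edges_def S_def[symmetric] using pairs by blast
  moreover have "{{z a, z b}, {z b, z c}, {z c, z d}, {z d, z a}} \<subseteq> quadrilateral_edges {z a, z b} {z c, z d}"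
    unfolding quadrilateral_edges_def S_def[symmetric]
    using ab bc cd da ne by (simp add: S_def)
  ultimately show ?thesis by (rule antisym)
qed

section \<open>Lifting matchings to the integers\<close>

text \<open>The bound by \<open>N\<close> selects one representative of the partner, so that a
  matching has exactly one lift. Crossings are excluded only between two openers; closers are
  reached through the involution.\<close>

definition lifted_matching :: "(int \<Rightarrow> int) \<Rightarrow> bool" where
  "lifted_matching p \<longleftrightarrow> (\<forall>k. p (p k) = k) \<and> (\<forall>k. odd (p k - k)) \<and> (\<forall>k. \<bar>p k - k\<bar> < N)
     \<and> (\<forall>k. p (k + 2 * N) = p k + 2 * N) \<and> (\<forall>k l. \<not> (k < l \<and> l < p k \<and> p k < p l))"

definition chords :: "(int \<Rightarrow> int) \<Rightarrow> complex set set" where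
  "chords p = range (\<lambda>k. {z k, z (p k)})"

lemma translation_mult:
  fixes p :: "int \<Rightarrow> int"
  assumes "\<And>k. p (k + m) = p k + m"
  shows "p (k + m * j) = p k + m * j"
proof (induction j rule: int_induct[of _ 0])
  case (step1 i)
  then show ?case using assms[of "k + m * i"] by (simp add: algebra_simps)
next
  case (step2 i)
  then show ?case using assms[of "k + m * (i - 1)"] by (simp add: algebra_simps)
qed simp

lemma
  assumes "lifted_matching p"
  shows lm_inv: "p (p k) = k"
    and lm_odd: "odd (p k - k)"
    and lm_neq: "p k \<noteq> k"
    and lm_abs: "\<bar>p k - k\<bar> < N"
    and lm_less: "p k < k + N"
    and lm_greater: "k - N < p k"
    and lm_period: "p (k + 2 * N) = p k + 2 * N"
    and lm_period_mult: "p (k + 2 * N * j) = p k + 2 * N * j"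
    and lm_non_crossing: "k < l \<Longrightarrow> l < p k \<Longrightarrow> p k < p l \<Longrightarrow> False"
proof -
  show *: "p (p k) = k" "odd (p k - k)" "\<bar>p k - k\<bar> < N" and per: "\<And>k. p (k + 2 * N) = p k + 2 * N"
    and "k < l \<Longrightarrow> l < p k \<Longrightarrow> p k < p l \<Longrightarrow> False"
    using assms unfolding lifted_matching_def by blast+
  show "p k \<noteq> k" using *(2) by auto
  show "p k < k + N" "k - N < p k" using *(3) by auto
  show "p (k + 2 * N * j) = p k + 2 * N * j" using per by (rule translation_mult)
qed

lemma lm_inj: "lifted_matching p \<Longrightarrow> p k = p l \<longleftrightarrow> k = l"
  by (metis lm_inv)

lemma lm_congruent:
  assumes "lifted_matching p" "2 * N dvd x - y"
  shows "p x = p y + (x - y)"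
proof -
  obtain j where "x - y = 2 * N * j" using assms(2) by (auto elim: dvdE)
  then have "x = y + 2 * N * j" by simp
  then show ?thesis using lm_period_mult[OF assms(1), of y j] by simp
qed

text \<open>Non-crossing speaks of openers only: a chord leaving to the right is excluded at
  \<open>x\<close>, one leaving to the left at \<open>p x\<close>.\<close>

lemma lm_nested:
  assumes p: "lifted_matching p" and "k < x" "x < p k"
  shows "k < p x" "p x < p k"
proof -
  have "p x \<noteq> k" "p x \<noteq> p k"
    using assms lm_inv[OF p] by (metis less_irrefl)+
  then show "k < p x" "p x < p k"
    using assms lm_non_crossing[OF p, of k x] lm_non_crossing[OF p, of "p x" k] lm_inv[OF p, of x]
    by (metis linorder_neqE)+
qed

lemma chord_mem_iff:
  assumes p: "lifted_matching p"
  shows "{z x, z y} \<in> chords p \<longleftrightarrow> 2 * N dvd y - p x"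
proof
  assume "{z x, z y} \<in> chords p"
  then obtain k where "{z x, z y} = {z k, z (p k)}" by (auto simp: chords_def)
  then consider "z x = z k" "z y = z (p k)" | "z x = z (p k)" "z y = z k"
    by (auto simp: doubleton_eq_iff)
  then show "2 * N dvd y - p x"
  proof cases
    case 1
    then have "2 * N dvd (y - p k) - (x - k)" unfolding z_eq_iff by (rule dvd_diff[rotated])
    moreover have "y - p x = (y - p k) - (x - k)"
      using lm_congruent[OF p, of x k] 1 by (simp add: z_eq_iff)
    ultimately show ?thesis by (simp only:)
  next
    case 2
    then have "2 * N dvd (y - k) - (x - p k)" unfolding z_eq_iff by (rule dvd_diff[rotated])
    moreover have "y - p x = (y - k) - (x - p k)"
      using lm_congruent[OF p, of x "p k"] 2 lm_inv[OF p, of k] by (simp add: z_eq_iff)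
    ultimately show ?thesis by (simp only:)
  qed
next
  assume "2 * N dvd y - p x"
  then have "z y = z (p x)" by (simp add: z_eq_iff)
  then show "{z x, z y} \<in> chords p" by (auto simp: chords_def)
qed

lemma chord_eqI:
  assumes p: "lifted_matching p" and "e \<in> chords p" "z x \<in> e"
  shows "e = {z x, z (p x)}"
proof -
  obtain k where k: "e = {z k, z (p k)}" using assms by (auto simp: chords_def)
  then obtain y where y: "e = {z x, z y}"
    using \<open>z x \<in> e\<close> by (cases "z x = z k") (auto simp: insert_commute)
  then have "z y = z (p x)"
    using chord_mem_iff[OF p, of x y] assms(2) by (simp add: z_eq_iff)
  then show ?thesis using y by simp
qed

lemma z_neq: "lifted_matching p \<Longrightarrow> z k \<noteq> z (p k)"
  using z_eq_imp_eq[of k "p k"] lm_abs[of p k] lm_neq[of p k] by (auto simp: abs_minus_commute)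

lemma chord_openE:
  assumes p: "lifted_matching p" and "e \<in> chords p"
  obtains a where "e = {z a, z (p a)}" "a < p a"
proof -
  obtain k where k: "e = {z k, z (p k)}" using assms by (auto simp: chords_def)
  show ?thesis
  proof (cases "k < p k")
    case True
    then show ?thesis using that k by simp
  next
    case False
    then show ?thesis using that[of "p k"] k lm_inv[OF p, of k] lm_neq[OF p, of k]
      by (simp add: insert_commute)
  qed
qed

text \<open>\<open>chords_disjoint_iff\<close> reads all indices in the window starting at
  \<open>a\<close>, while \<open>p c\<close> may fall outside it. A shift by one period brings it
  back, and nesting keeps it on the same side of the chord from \<open>a\<close>.\<close>

lemma window_partner:
  assumes p: "lifted_matching p" and "a < p a" "a < c" "c < a + 2 * N" "c \<noteq> p a"
  shows "\<exists>d. z d = z (p c) \<and> a < d \<and> d < a + 2 * N \<and> d \<noteq> p a \<and> (d < p a \<longleftrightarrow> c < p a)"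
proof (cases "c < p a")
  case True
  then show ?thesis using lm_nested[OF p, of a c] lm_less[OF p, of a] assms by (intro exI[of _ "p c"]) auto
next
  case False
  have b: "p a < a + N" using lm_less[OF p] .
  have c: "p a < c" using False assms by simp
  have ne: "p c \<noteq> a" "p c \<noteq> p a" "p c \<noteq> a + 2 * N" "p c \<noteq> p a + 2 * N"
    using assms lm_inv[OF p, of c] lm_inj[OF p, of c a] lm_inj[OF p, of c "a + 2 * N"]
      lm_period[OF p, of a] by auto
  have in1: "\<not> (a < p c \<and> p c < p a)"
    using lm_nested[OF p, of a "p c"] lm_inv[OF p, of c] c by auto
  have in2: "\<not> (a + 2 * N < p c \<and> p c < p a + 2 * N)"
    using lm_nested[OF p, of "a + 2 * N" "p c"] lm_inv[OF p, of c] lm_period[OF p, of a] assms by auto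
  have near: "p c < c + N" "c - N < p c" using lm_less[OF p] lm_greater[OF p] by auto
  consider "p c < a" | "p a < p c" "p c < a + 2 * N" | "p a + 2 * N < p c"
    using ne in1 in2 by linarith
  then show ?thesis
  proof cases
    case 1
    then show ?thesis using near c b assms z_period[of "p c" 1] by (intro exI[of _ "p c + 2 * N"]) auto
  next
    case 2
    then show ?thesis using c assms by (intro exI[of _ "p c"]) auto
  next
    case 3
    then show ?thesis using near c b assms z_period[of "p c" "-1"] by (intro exI[of _ "p c - 2 * N"]) auto
  qed
qed

lemma chords_in_matchings:
  assumes p: "lifted_matching p"
  shows "chords p \<in> matchings n"
proof -
  have "perfect_matching (circle_points n) (chords p)"
    unfolding perfect_matching_def circle_points_eq
  proof
    show "partition_on (range z) (chords p)"
      unfolding partition_on_def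
    proof (intro conjI disjointI)
      show "\<Union> (chords p) = range z" "{} \<notin> chords p"
        by (auto simp: chords_def)
      show "e \<inter> f = {}" if ef: "e \<in> chords p" "f \<in> chords p" "e \<noteq> f" for e f
      proof (rule ccontr)
        assume "e \<inter> f \<noteq> {}"
        then obtain w where w: "w \<in> e" "w \<in> f" by auto
        obtain x where "w = z x" using w ef by (auto simp: chords_def)
        then show False using chord_eqI[OF p, of e x] chord_eqI[OF p, of f x] w ef by auto
      qed
    qed
    show "\<forall>e\<in>chords p. card e = 2"
      using z_neq[OF p] by (auto simp: chords_def)
  qed
  moreover have "non_crossing (chords p)"
    unfolding non_crossing_def
  proof (rule pairwiseI)
    fix e f assume ef: "e \<in> chords p" "f \<in> chords p" "e \<noteq> f"
    obtain a where a: "e = {z a, z (p a)}" "a < p a" using chord_openE[OF p ef(1)] .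
    obtain c' where "f = {z c', z (p c')}" using ef by (auto simp: chords_def)
    moreover obtain c where c: "c \<in> {a..<a + 2 * N}" "z c = z c'" using z_surj_window by blast
    ultimately have f: "f = {z c, z (p c)}" using chord_eqI[OF p ef(2), of c] by simp
    have "c \<noteq> a" "c \<noteq> p a" using ef a f lm_inv[OF p] by (auto simp: insert_commute)
    then obtain d where d: "z d = z (p c)" "a < d" "d < a + 2 * N" "d \<noteq> p a" "d < p a \<longleftrightarrow> c < p a"
      using window_partner[OF p, of a c] a c by auto
    have "p a < a + 2 * N" using lm_less[OF p, of a] by simp
    then have "disjnt (convex hull {z a, z (p a)}) (convex hull {z c, z d})"
      using chords_disjoint_iff[of a "p a" c d] a c d \<open>c \<noteq> a\<close> \<open>c \<noteq> p a\<close> by auto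
    then show "disjnt (convex hull e) (convex hull f)" using a f d by simp
  qed
  ultimately show ?thesis by (simp add: matchings_def)
qed

section \<open>From matchings to lifts\<close>

lemma matching_chordE:
  assumes "M \<in> matchings n" "e \<in> M"
  obtains x y where "e = {z x, z y}" "x < y" "y < x + 2 * N"
proof -
  have "e \<subseteq> range z" "card e = 2"
    using assms by (auto simp: matchings_def perfect_matching_def circle_points_eq partition_on_def)
  then obtain x y' where e: "e = {z x, z y'}" "z x \<noteq> z y'"
    by (auto simp: card_2_iff)
  obtain y where "y \<in> {x..<x + 2 * N}" "z y = z y'" using z_surj_window by blast
  then show ?thesis using that[of x y] e by (cases "x = y") auto
qed

lemma matching_hulls_disjnt:
  "M \<in> matchings n \<Longrightarrow> e \<in> M \<Longrightarrow> f \<in> M \<Longrightarrow> e \<noteq> f \<Longrightarrow> disjnt (convex hull e) (convex hull f)"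
  by (simp add: matchings_def non_crossing_def pairwise_def)

lemma matching_partner_unique:
  assumes M: "M \<in> matchings n" and "{z k, z l} \<in> M" "{z k, z l'} \<in> M"
  shows "z l = z l'"
proof -
  have "{z k, z l} = {z k, z l'}"
  proof -
    have "disjoint M"
      using M by (simp add: matchings_def perfect_matching_def partition_on_def)
    then have "{z k, z l} \<inter> {z k, z l'} = {} \<or> {z k, z l} = {z k, z l'}"
      using assms(2,3) by (meson disjointD)
    then show ?thesis by simp
  qed
  then show ?thesis by (auto simp: doubleton_eq_iff)
qed

lemma matching_partner_ex:
  assumes M: "M \<in> matchings n"
  shows "\<exists>l. {z k, z l} \<in> M"
proof -
  have "z k \<in> \<Union> M"
    using M by (auto simp: matchings_def perfect_matching_def circle_points_eq partition_on_def)
  then obtain e where e: "e \<in> M" "z k \<in> e" by blast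
  obtain x y where "e = {z x, z y}" using matching_chordE[OF M e(1)] .
  then show ?thesis using e by (auto simp: insert_commute)
qed

lemma matching_chord_irrefl:
  assumes M: "M \<in> matchings n"
  shows "{z k, z k} \<notin> M"
proof
  assume "{z k, z k} \<in> M"
  then have "card {z k, z k} = 2" using M unfolding matchings_def perfect_matching_def by blast
  then show False by simp
qed

lemma matching_chord_window:
  assumes M: "M \<in> matchings n" and ab: "{z a, z b} \<in> M" "a < b" "b < a + 2 * N" and x: "a < x" "x < b"
  shows "\<exists>y. a < y \<and> y < b \<and> {z x, z y} \<in> M"
proof -
  obtain l where l: "{z x, z l} \<in> M" using matching_partner_ex[OF M] by blast
  obtain y where y: "y \<in> {a..<a + 2 * N}" "z y = z l" using z_surj_window by blast
  have xa: "z x \<noteq> z a" "z x \<noteq> z b" using z_eq_imp_eq[of x a] z_eq_imp_eq[of x b] x ab by auto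
  have xy: "{z x, z y} \<in> M" using l y by simp
  have "y \<noteq> a"
    using matching_partner_unique[OF M, of a b x] xy ab(1) xa by (auto simp: insert_commute)
  moreover have "y \<noteq> b"
    using matching_partner_unique[OF M, of b a x] xy ab(1) xa by (auto simp: insert_commute)
  moreover have "disjnt (convex hull {z a, z b}) (convex hull {z x, z y})"
    using matching_hulls_disjnt[OF M ab(1) xy] xa by (auto simp: doubleton_eq_iff)
  ultimately have "y < b" "a < y" using chords_disjoint_iff[of a b x y] x y ab by auto
  then show ?thesis using xy by blast
qed

text \<open>The points strictly between the ends of a chord are matched among themselves, so their
  number is even.\<close>

lemma matching_chord_odd:
  assumes M: "M \<in> matchings n" and ab: "{z a, z b} \<in> M" "a < b" "b < a + 2 * N"
  shows "odd (b - a)"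
proof -
  define f where "f x = (SOME y. a < y \<and> y < b \<and> {z x, z y} \<in> M)" for x
  have f: "a < f x" "f x < b" "{z x, z (f x)} \<in> M" if "a < x" "x < b" for x
    using someI_ex[OF matching_chord_window[OF M ab that]] unfolding f_def by auto
  have "even (card {a<..<b})"
  proof (rule even_card_fixpoint_free_involution)
    fix x assume "x \<in> {a<..<b}"
    then have x: "a < x" "x < b" by auto
    show "f x \<in> {a<..<b}" using f[OF x] by simp
    show "f x \<noteq> x" using f(3)[OF x] matching_chord_irrefl[OF M, of x] by metis
    note fx = f[OF f(1,2)[OF x]]
    have "z x = z (f (f x))"
      using matching_partner_unique[OF M, of "f x" x "f (f x)"] fx(3) f(3)[OF x]
      by (simp add: insert_commute)
    moreover have "\<bar>x - f (f x)\<bar> < 2 * N" using fx x ab by (simp add: abs_less_iff)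
    ultimately show "f (f x) = x" using z_eq_imp_eq by metis
  qed simp
  then show ?thesis using ab by (simp add: even_nat_iff)
qed

lemma matching_partner_near:
  assumes M: "M \<in> matchings n"
  shows "\<exists>l. {z k, z l} \<in> M \<and> odd (l - k) \<and> \<bar>l - k\<bar> < N"
proof -
  obtain l' where l': "{z k, z l'} \<in> M" using matching_partner_ex[OF M] by blast
  obtain l where l: "l \<in> {k..<k + 2 * N}" "z l = z l'" using z_surj_window by blast
  have kl: "{z k, z l} \<in> M" using l l' by simp
  then have "k \<noteq> l" using matching_chord_irrefl[OF M, of k] by auto
  then have odd: "odd (l - k)" using matching_chord_odd[OF M kl] l by simp
  \<comment> \<open>A diameter would have the even length \<open>N\<close>, against the odd length
    of a chord.\<close>
  then have "l \<noteq> k + N" using even_n by auto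
  show ?thesis
  proof (cases "l < k + N")
    case True
    then show ?thesis using kl l odd by (intro exI[of _ l]) auto
  next
    case False
    then show ?thesis using kl l odd \<open>l \<noteq> k + N\<close> z_period[of l "-1"]
      by (intro exI[of _ "l - 2 * N"]) auto
  qed
qed

lemma ex_lifted_matching:
  assumes M: "M \<in> matchings n"
  obtains p where "lifted_matching p" "chords p = M"
proof -
  define p where "p k = (SOME l. {z k, z l} \<in> M \<and> odd (l - k) \<and> \<bar>l - k\<bar> < N)" for k
  have p: "{z k, z (p k)} \<in> M" "odd (p k - k)" "\<bar>p k - k\<bar> < N" for k
    using someI_ex[OF matching_partner_near[OF M, of k]] unfolding p_def by auto
  \<comment> \<open>The partner is determined modulo \<open>2 * N\<close>, and only one
    representative is within distance \<open>N\<close>. The involution and the periodicity of the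
    lift both follow from this.\<close>
  have unique: "l = p k" if "{z k, z l} \<in> M" "\<bar>l - k\<bar> < N" for k l
    using matching_partner_unique[OF M that(1) p(1)] p(3)[of k] that(2) by (intro z_eq_imp_eq) auto
  have "lifted_matching p"
    unfolding lifted_matching_def
  proof (intro conjI allI)
    fix k l
    show "p (p k) = k"
      using unique[of "p k" k] p(1,3)[of k] by (simp add: insert_commute abs_minus_commute)
    show "odd (p k - k)" "\<bar>p k - k\<bar> < N" using p by auto
    show "p (k + 2 * N) = p k + 2 * N"
      using unique[of "k + 2 * N" "p k + 2 * N"] p(1,3)[of k] z_period[of k 1] z_period[of "p k" 1]
      by simp
    show "\<not> (k < l \<and> l < p k \<and> p k < p l)"
    proof
      assume kl: "k < l \<and> l < p k \<and> p k < p l"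
      have near: "p k < k + N" "p l < l + N" "l < k + N" using p(3)[of k] p(3)[of l] kl by auto
      have "z l \<noteq> z k" "z l \<noteq> z (p k)"
        using z_eq_imp_eq[of l k] z_eq_imp_eq[of l "p k"] kl near by auto
      then have "{z k, z (p k)} \<noteq> {z l, z (p l)}" by auto
      then have "disjnt (convex hull {z k, z (p k)}) (convex hull {z l, z (p l)})"
        using matching_hulls_disjnt[OF M p(1) p(1)] by simp
      then show False using chords_disjoint_iff[of k "p k" l "p l"] kl near by auto
    qed
  qed
  moreover have "chords p = M"
  proof
    show "chords p \<subseteq> M" using p by (auto simp: chords_def)
    show "M \<subseteq> chords p"
    proof
      fix e assume "e \<in> M"
      obtain x y where e: "e = {z x, z y}" using matching_chordE[OF M \<open>e \<in> M\<close>] .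
      then have "z y = z (p x)" using matching_partner_unique[OF M, of x y "p x"] \<open>e \<in> M\<close> p by simp
      then show "e \<in> chords p" using e by (auto simp: chords_def)
    qed
  qed
  ultimately show ?thesis using that by blast
qed

lemma congruent_near_eq: "2 * N dvd x - y \<Longrightarrow> \<bar>x - k\<bar> < N \<Longrightarrow> \<bar>y - k\<bar> < N \<Longrightarrow> x = y"
  using z_eq_imp_eq[of x y] unfolding z_eq_iff by linarith

lemma chords_inj:
  assumes "lifted_matching p" "lifted_matching q" "chords p = chords q"
  shows "p = q"
proof
  fix k
  have "{z k, z (p k)} \<in> chords q" using assms(3) by (auto simp: chords_def)
  then have "2 * N dvd p k - q k" using chord_mem_iff[OF assms(2)] by simp
  then show "p k = q k" using lm_abs[OF assms(1), of k] lm_abs[OF assms(2), of k] by (rule congruent_near_eq)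
qed

text \<open>Point reflection shifts indices by \<open>N\<close>. The resulting congruence is an
  equality because both representatives are within \<open>N\<close> of \<open>k + N\<close>.\<close>

lemma centrally_symmetric_chords_iff:
  assumes p: "lifted_matching p"
  shows "centrally_symmetric (chords p) \<longleftrightarrow> (\<forall>k. p (k + N) = p k + N)"
proof
  assume sym: "centrally_symmetric (chords p)"
  show "\<forall>k. p (k + N) = p k + N"
  proof
    fix k
    have "{z k, z (p k)} \<in> chords p" by (auto simp: chords_def)
    then have "uminus ` {z k, z (p k)} \<in> chords p"
      using sym unfolding centrally_symmetric_def by blast
    then have "{z (k + N), z (p k + N)} \<in> chords p" by (simp add: uminus_z)
    then have "2 * N dvd (p k + N) - p (k + N)" using chord_mem_iff[OF p] by simp
    moreover have "\<bar>p k + N - (k + N)\<bar> < N" "\<bar>p (k + N) - (k + N)\<bar> < N"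
      using lm_abs[OF p, of k] lm_abs[OF p, of "k + N"] by auto
    ultimately show "p (k + N) = p k + N" using congruent_near_eq by metis
  qed
next
  assume sym: "\<forall>k. p (k + N) = p k + N"
  have "(\<lambda>e. uminus ` e) ` chords p = range (\<lambda>k. {z (k + N), z (p (k + N))})"
    using sym by (simp add: chords_def image_image uminus_z)
  also have "\<dots> = (\<lambda>k. {z k, z (p k)}) ` range (\<lambda>k. k + N)"
    by (rule image_image[symmetric])
  also have "range (\<lambda>k. k + N) = UNIV" by (rule surj_plus_right)
  finally show "centrally_symmetric (chords p)"
    by (simp add: centrally_symmetric_def chords_def)
qed

section \<open>Centered flips of lifts\<close>

text \<open>The arcs \<open>(a, b)\<close> and \<open>(c, d)\<close> become \<open>(b, c)\<close> and \<open>(d, a + 2n)\<close>. Since every arc of a lift has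
  length below \<open>n\<close>, this forces all four gaps to be less than a half circle, so the flip is centered.\<close>

definition flips_at :: "(int \<Rightarrow> int) \<Rightarrow> (int \<Rightarrow> int) \<Rightarrow> int \<Rightarrow> int \<Rightarrow> bool" where
  "flips_at p q a c \<longleftrightarrow> a < p a \<and> p a < c \<and> c < p c \<and> p c < a + 2 * N \<and> q (p a) = c \<and> q (p c) = a + 2 * N
     \<and> (\<forall>x. (\<forall>y\<in>{a, p a, c, p c}. \<not> 2 * N dvd x - y) \<longrightarrow> q x = p x)"

lemma not_dvd_window: "x \<noteq> y \<Longrightarrow> \<bar>x - y\<bar> < 2 * N \<Longrightarrow> \<not> 2 * N dvd x - y"
  using z_eq_imp_eq[of x y] unfolding z_eq_iff by blast

text \<open>In every other relative position, with nested chords or a gap longer than a half circle,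
  the quadrilateral sits on an arc shorter than a half circle and misses the center.\<close>

lemma centered_flip_imp_flips_at:
  assumes p: "lifted_matching p" and q: "lifted_matching q" and "centered_flip (chords p) (chords q)"
  shows "\<exists>a c. flips_at p q a c"
proof -
  obtain e f where ef: "e \<in> chords p" "f \<in> chords p" "e \<noteq> f"
    and zero: "0 \<in> convex hull (e \<union> f)"
    and Q: "chords q = (chords p - {e, f}) \<union> (quadrilateral_edges e f - {e, f})"
    using assms(3) unfolding centered_flip_def by (elim bexE conjE) (rule that)
  obtain a where a: "e = {z a, z (p a)}" "a < p a" using chord_openE[OF p ef(1)] .
  obtain c' where c': "f = {z c', z (p c')}" "c' < p c'" using chord_openE[OF p ef(2)] .
  obtain c where c: "c \<in> {a..<a + 2 * N}" "z c = z c'" using z_surj_window by blast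
  have f: "f = {z c, z (p c)}" using chord_eqI[OF p ef(2), of c] c c' by simp
  have cd: "c < p c" using lm_congruent[OF p, of c c'] c c' by (simp add: z_eq_iff)
  have "c \<noteq> a" using ef a f by auto
  have "c \<noteq> p a" using cd lm_inv[OF p, of a] a by auto
  have near: "p a < a + N" "p c < c + N" using lm_less[OF p] by auto
  have bc: "p a < c"
  proof (rule ccontr)
    assume "\<not> p a < c"
    then have "a < c" "c < p a" using \<open>c \<noteq> p a\<close> \<open>c \<noteq> a\<close> c by auto
    moreover from this have "a < p c" "p c < p a" using lm_nested[OF p] by auto
    ultimately have "0 \<notin> convex hull (e \<union> f)"
      using a f near by (intro zero_notin_arc_hull[of a "p a"]) (auto simp: z_mem_image)
    then show False using zero by simp
  qed
  have da: "p c < a + 2 * N"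
  proof (rule ccontr)
    assume "\<not> p c < a + 2 * N"
    moreover have "p c \<noteq> a + 2 * N"
      using lm_inv[OF p, of c] lm_period[OF p, of a] c a by auto
    ultimately have "c < a + 2 * N" "a + 2 * N < p c" using c by auto
    moreover from this have "p a + 2 * N < p c"
      using lm_nested[OF p, of c "a + 2 * N"] lm_period[OF p, of a] by simp
    ultimately have "e \<union> f \<subseteq> z ` {c..p c}"
      using a f cd by (auto simp: z_mem_image z_mem_image_shift)
    then have "0 \<notin> convex hull (e \<union> f)"
      using near cd by (intro zero_notin_arc_hull[of c "p c"]) auto
    then show False using zero by simp
  qed
  have bc_near: "c \<le> p a + N"
  proof (rule ccontr)
    assume "\<not> c \<le> p a + N"
    moreover from this have "e \<union> f \<subseteq> z ` {c..p a + 2 * N}"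
      using a f cd da c(1) by (auto simp: z_mem_image z_mem_image_shift)
    ultimately have "0 \<notin> convex hull (e \<union> f)"
      using a da cd by (intro zero_notin_arc_hull[of c "p a + 2 * N"]) auto
    then show False using zero by simp
  qed
  have da_near: "a + N \<le> p c"
  proof (rule ccontr)
    assume "\<not> a + N \<le> p c"
    moreover have "e \<union> f \<subseteq> z ` {a..p c}"
      using a f cd bc by (auto simp: z_mem_image)
    ultimately have "0 \<notin> convex hull (e \<union> f)"
      using a bc cd by (intro zero_notin_arc_hull[of a "p c"]) auto
    then show False using zero by simp
  qed
  have neq: "z a \<noteq> z (p a)" "z a \<noteq> z c" "z a \<noteq> z (p c)" "z (p a) \<noteq> z c" "z (p a) \<noteq> z (p c)" "z c \<noteq> z (p c)"
    using a bc cd da by (simp_all add: z_neq_window)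
  have edges: "quadrilateral_edges e f = {e, {z (p a), z c}, f, {z (p c), z a}}"
    using quadrilateral_edges_z[OF a(2) bc cd da] a f by simp
  have "{z (p a), z c} \<in> chords q" "{z (p c), z (a + 2 * N)} \<in> chords q"
    unfolding Q edges using neq a f z_period[of a 1] by (auto simp: doubleton_eq_iff)
  then have cong: "2 * N dvd c - q (p a)" "2 * N dvd (a + 2 * N) - q (p c)"
    using chord_mem_iff[OF q] by auto
  \<comment> \<open>The center may lie on a side of the quadrilateral, so gaps equal to
    \<open>N\<close> are still possible at this point. Such a side would be a diameter in
    \<open>q\<close>, against parity.\<close>
  have no_diameter: False if "2 * N dvd (x + N) - q x" for x
  proof -
    have "even ((x + N) - q x)" using that by (meson dvd_mult_left dvd_trans dvd_triv_left)
    then show False using lm_odd[OF q, of x] even_n by simp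
  qed
  have 1: "c = q (p a)"
  proof (rule congruent_near_eq[OF cong(1)])
    show "\<bar>c - p a\<bar> < N" using no_diameter[of "p a"] cong(1) bc bc_near
      by (cases "c = p a + N") auto
    show "\<bar>q (p a) - p a\<bar> < N" using lm_abs[OF q] .
  qed
  have 2: "a + 2 * N = q (p c)"
  proof (rule congruent_near_eq[OF cong(2)])
    show "\<bar>a + 2 * N - p c\<bar> < N"
    proof (cases "a + 2 * N = p c + N")
      case True
      have "2 * N dvd (p c + N) - q (p c)" using cong(2) by (simp only: True)
      then show ?thesis using no_diameter by blast
    qed (use da da_near in auto)
    show "\<bar>q (p c) - p c\<bar> < N" using lm_abs[OF q] .
  qed
  have 3: "q x = p x" if "\<forall>y\<in>{a, p a, c, p c}. \<not> 2 * N dvd x - y" for x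
  proof -
    have "{z x, z (p x)} \<in> chords p" by (auto simp: chords_def)
    moreover have "z x \<notin> e \<union> f" using that a f by (auto simp: z_eq_iff)
    ultimately have "{z x, z (p x)} \<in> chords q" unfolding Q by auto
    then have "2 * N dvd p x - q x" using chord_mem_iff[OF q] by simp
    then show ?thesis using congruent_near_eq[OF _ lm_abs[OF p] lm_abs[OF q]] by metis
  qed
  have "flips_at p q a c"
    unfolding flips_at_def
  proof (intro conjI allI impI)
    show "q (p a) = c" "q (p c) = a + 2 * N" using 1 2 by (simp_all only:)
  qed (fact a bc cd da 3)+
  then show ?thesis by blast
qed

lemma flips_atD:
  assumes p: "lifted_matching p" and q: "lifted_matching q" and "flips_at p q a c"
  shows "a < p a" "p a < c" "c < p c" "p c < a + 2 * N" "q (p a) = c" "q (p c) = a + 2 * N"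
    "q c = p a" "q a = p c - 2 * N" "c < p a + N" "a + N < p c"
    "\<And>x. (\<And>y. y \<in> {a, p a, c, p c} \<Longrightarrow> \<not> 2 * N dvd x - y) \<Longrightarrow> q x = p x"
    "\<And>x. a < x \<Longrightarrow> x < a + 2 * N \<Longrightarrow> x \<noteq> p a \<Longrightarrow> x \<noteq> c \<Longrightarrow> x \<noteq> p c \<Longrightarrow> q x = p x"
proof -
  show *: "a < p a" "p a < c" "c < p c" "p c < a + 2 * N" "q (p a) = c" "q (p c) = a + 2 * N"
    and **: "\<And>x. (\<And>y. y \<in> {a, p a, c, p c} \<Longrightarrow> \<not> 2 * N dvd x - y) \<Longrightarrow> q x = p x"
    using assms(3) unfolding flips_at_def by auto
  show "q c = p a" using lm_inv[OF q, of "p a"] * by simp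
  show "q a = p c - 2 * N" using lm_inv[OF q, of "p c"] lm_period[OF q, of a] * by simp
  show "c < p a + N" "a + N < p c" using lm_less[OF q, of "p a"] lm_less[OF q, of "p c"] * by auto
  show "q x = p x" if "a < x" "x < a + 2 * N" "x \<noteq> p a" "x \<noteq> c" "x \<noteq> p c" for x
  proof (rule **)
    fix y assume "y \<in> {a, p a, c, p c}"
    then show "\<not> 2 * N dvd x - y" using that * by (intro not_dvd_window) auto
  qed
qed

text \<open>Emptiness comes from nesting on both sides of the flip: a remaining chord under
  \<open>(a, b)\<close> or \<open>(c, d)\<close> is confined by \<open>p\<close>, one under
  \<open>(b, c)\<close> or \<open>(d, a + 2 * N)\<close> by \<open>q\<close>. Hence each lies
  strictly inside one gap between consecutive vertices.\<close>

lemma flips_at_imp_centered_flip: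
  assumes p: "lifted_matching p" and q: "lifted_matching q" and "flips_at p q a c"
  shows "centered_flip (chords p) (chords q)"
proof -
  define b d where "b = p a" and "d = p c"
  note flip = flips_atD[OF p q assms(3), folded b_def d_def]
  have near: "b < a + N" "d < c + N" using lm_less[OF p] unfolding b_def d_def by auto
  define e f where "e = {z a, z b}" and "f = {z c, z d}"
  have pbd: "p b = a" "p d = c" using lm_inv[OF p] by (auto simp: b_def d_def)
  have ef: "e \<in> chords p" "f \<in> chords p"
    by (auto simp: e_def f_def b_def d_def chords_def)
  have neq: "z a \<noteq> z b" "z a \<noteq> z c" "z a \<noteq> z d" "z b \<noteq> z c" "z b \<noteq> z d" "z c \<noteq> z d"
    using flip(1-4) by (simp_all add: z_neq_window)
  have "e \<noteq> f" using neq by (auto simp: e_def f_def doubleton_eq_iff)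
  have edges: "quadrilateral_edges e f - {e, f} = {{z b, z c}, {z d, z a}}"
    using quadrilateral_edges_z[OF flip(1-4)] neq by (auto simp: e_def f_def doubleton_eq_iff)
  have other: "\<exists>x. g = {z x, z (p x)} \<and> q x = p x \<and> a < x \<and> x < a + 2 * N \<and> x \<notin> {b, c, d}"
    if g: "g \<in> chords p - {e, f}" for g
  proof -
    obtain x' where x': "g = {z x', z (p x')}" using g by (auto simp: chords_def)
    obtain x where x: "x \<in> {a..<a + 2 * N}" "z x = z x'" using z_surj_window by blast
    have gx: "g = {z x, z (p x)}" using chord_eqI[OF p, of g x] x x' g by auto
    then have "x \<noteq> a" "x \<noteq> b" "x \<noteq> c" "x \<noteq> d"
      using g lm_inv[OF p] unfolding e_def f_def b_def d_def by (auto simp: insert_commute)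
    then show ?thesis using x(1) gx flip(12)[of x] by (intro exI[of _ x]) auto
  qed
  have "empty_quadrilateral (chords p) e f"
    unfolding empty_quadrilateral_def
  proof
    fix g assume "g \<in> chords p - {e, f}"
    then obtain x where x: "g = {z x, z (p x)}" "q x = p x" "a < x" "x < a + 2 * N" "x \<notin> {b, c, d}"
      using other by blast
    then consider "a < x" "x < b" | "b < x" "x < c" | "c < x" "x < d" | "d < x" "x < a + 2 * N"
      by fastforce
    then obtain l u where "l \<le> u \<and> u < l + 2 * N \<and> g \<subseteq> z ` {l..u} \<and> e \<union> f \<subseteq> z ` {u<..<l + 2 * N}"
    proof cases
      case 1
      then have "a < p x" "p x < b" using lm_nested[OF p, of a x] by (auto simp: b_def)
      then show ?thesis using 1 x flip(1-4) 
        by (intro that[of "a + 1" "b - 1"]) (auto simp: e_def f_def z_mem_image z_mem_image_shift)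
    next
      case 2
      then have "b < p x" "p x < c" using lm_nested[OF q, of b x] x flip(5) by auto
      then show ?thesis using 2 x flip(1-4) 
        by (intro that[of "b + 1" "c - 1"]) (auto simp: e_def f_def z_mem_image z_mem_image_shift)
    next
      case 3
      then have "c < p x" "p x < d" using lm_nested[OF p, of c x] by (auto simp: d_def)
      then show ?thesis using 3 x flip(1-4) 
        by (intro that[of "c + 1" "d - 1"]) (auto simp: e_def f_def z_mem_image z_mem_image_shift)
    next
      case 4
      then have "d < p x" "p x < a + 2 * N" using lm_nested[OF q, of d x] x flip(6) by auto
      then show ?thesis using 4 x flip(1-4) 
        by (intro that[of "d + 1" "a + 2 * N - 1"]) (auto simp: e_def f_def z_mem_image_shift z_mem_image)
    qed
    then show "disjnt (convex hull g) (convex hull (e \<union> f))"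
      using arc_hull_disjoint[of l u g "e \<union> f"] by (simp add: disjnt_def)
  qed
  moreover have "0 \<in> convex hull (e \<union> f)"
    using zero_in_quadrilateral[of a b c d] flip(1-4,9,10) near
    by (simp add: e_def f_def insert_commute)
  moreover have "chords q = (chords p - {e, f}) \<union> {{z b, z c}, {z d, z a}}"
  proof
    have "{z b, z (q b)} \<in> chords q" "{z d, z (q d)} \<in> chords q" by (auto simp: chords_def)
    then have "{z b, z c} \<in> chords q" "{z d, z a} \<in> chords q"
      using flip(5,6) z_period[of a 1] by auto
    moreover have "g \<in> chords q" if g: "g \<in> chords p - {e, f}" for g
    proof -
      obtain x where "g = {z x, z (q x)}" using other[OF g] by metis
      then show ?thesis by (auto simp: chords_def)
    qed
    ultimately show "(chords p - {e, f}) \<union> {{z b, z c}, {z d, z a}} \<subseteq> chords q" by blast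
    show "chords q \<subseteq> (chords p - {e, f}) \<union> {{z b, z c}, {z d, z a}}"
    proof
      fix g assume g: "g \<in> chords q"
      then obtain x' where x': "g = {z x', z (q x')}" by (auto simp: chords_def)
      obtain x where x: "x \<in> {a..<a + 2 * N}" "z x = z x'" using z_surj_window by blast
      have gx: "g = {z x, z (q x)}" using chord_eqI[OF q, of g x] x x' g by auto
      show "g \<in> (chords p - {e, f}) \<union> {{z b, z c}, {z d, z a}}"
      proof (cases "x \<in> {a, b, c, d}")
        case True
        then show ?thesis using gx flip(5-8) z_period[of a 1] z_period[of d "-1"] by (auto simp: insert_commute)
      next
        case False
        then have "q x = p x" using flip(12)[of x] x by auto
        moreover have "z x \<notin> e \<union> f"
        proof -
          have "z x \<noteq> z y" if "y \<in> {a, b, c, d}" for y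
            unfolding z_eq_iff using that False x(1) flip(1-4) by (intro not_dvd_window) auto
          then show ?thesis unfolding e_def f_def by simp
        qed
        ultimately show ?thesis using gx by (auto simp: chords_def)
      qed
    qed
  qed
  ultimately show ?thesis
    unfolding centered_flip_def using ef \<open>e \<noteq> f\<close>
    by (intro bexI[of _ e] bexI[of _ f] conjI; simp only: edges)
qed

lemma H_edge_iff:
  assumes p: "lifted_matching p" and q: "lifted_matching q"
  shows "{chords p, chords q} \<in> H_edges n \<longleftrightarrow> (\<exists>a c. flips_at p q a c) \<or> (\<exists>a c. flips_at q p a c)"
proof
  assume "{chords p, chords q} \<in> H_edges n"
  then have "centered_flip (chords p) (chords q) \<or> centered_flip (chords q) (chords p)"
    by (auto simp: H_edges_def doubleton_eq_iff)
  then show "(\<exists>a c. flips_at p q a c) \<or> (\<exists>a c. flips_at q p a c)"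
    using centered_flip_imp_flips_at p q by blast
next
  assume "(\<exists>a c. flips_at p q a c) \<or> (\<exists>a c. flips_at q p a c)"
  then have "centered_flip (chords p) (chords q) \<or> centered_flip (chords q) (chords p)"
    using flips_at_imp_centered_flip p q by blast
  then show "{chords p, chords q} \<in> H_edges n"
    using chords_in_matchings p q unfolding H_edges_def by blast
qed

text \<open>The reverse flip sees the same four points starting one vertex later, so
  \<open>a\<close> reappears as \<open>a + 2 * N\<close>.\<close>

lemma flips_at_sym:
  assumes p: "lifted_matching p" and q: "lifted_matching q" and "flips_at p q a c"
  shows "flips_at q p (p a) (p c)"
proof -
  note flip = flips_atD[OF assms]
  have "p x = q x" if "\<forall>y\<in>{p a, c, p c, a + 2 * N}. \<not> 2 * N dvd x - y" for x
  proof -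
    have "2 * N dvd (x - a) + (- 1) * (2 * N) \<longleftrightarrow> 2 * N dvd x - a"
      by (rule dvd_add_times_triv_right_iff)
    then show ?thesis using that by (intro flip(11)[symmetric]) (auto simp: algebra_simps)
  qed
  note same = this
  show ?thesis
    unfolding flips_at_def flip(5,6) lm_inv[OF p] lm_period[OF p, of a]
  proof (intro conjI allI impI)
    show "p a < c" "c < p c" "p c < a + 2 * N" "a + 2 * N < p a + 2 * N" using flip(1-4) by simp_all
  qed (fact refl same)+
qed

section \<open>The central face\<close>

text \<open>The positions between consecutive edges of the face containing the center.\<close>

definition cuts :: "(int \<Rightarrow> int) \<Rightarrow> int set" where
  "cuts p = {x. \<forall>y<x. p y < x}"

lemma cutsD: "x \<in> cuts p \<Longrightarrow> y < x \<Longrightarrow> p y < x"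
  by (simp add: cuts_def)

lemma cut_opener:
  assumes p: "lifted_matching p" and "x \<in> cuts p"
  shows "x < p x"
  using cutsD[OF assms(2), of "p x"] lm_inv[OF p, of x] lm_neq[OF p, of x] by force

text \<open>A cut \<open>x\<close> stands for the gap just before \<open>z x\<close>; hence the
  chord opening at a cut ends one position before the next cut.\<close>

lemma next_cut:
  assumes p: "lifted_matching p" and x: "x \<in> cuts p"
  shows "p x + 1 \<in> cuts p"
  unfolding cuts_def
proof (intro CollectI allI impI)
  fix y assume "y < p x + 1"
  then consider "y < x" | "y = x" | "x < y" "y < p x" | "y = p x" by linarith
  then show "p y < p x + 1"
  proof cases
    case 1
    then show ?thesis using cutsD[OF x, of y] cut_opener[OF assms] by simp
  next
    case 3
    then show ?thesis using lm_nested[OF p] by force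
  next
    case 4
    then show ?thesis using lm_inv[OF p] cut_opener[OF assms] by simp
  qed simp
qed

lemma prev_cut:
  assumes p: "lifted_matching p" and x: "x \<in> cuts p"
  shows "p (x - 1) < x - 1" "p (x - 1) \<in> cuts p"
proof -
  show less: "p (x - 1) < x - 1"
    using cutsD[OF x, of "x - 1"] lm_neq[OF p, of "x - 1"] by simp
  show "p (x - 1) \<in> cuts p"
    unfolding cuts_def
  proof (intro CollectI allI impI)
    fix y assume y: "y < p (x - 1)"
    have "p y < x" using cutsD[OF x, of y] y less by simp
    moreover have "p y \<noteq> x - 1" using lm_inv[OF p, of y] y by auto
    moreover have "p y \<noteq> p (x - 1)" using lm_inj[OF p, of y "x - 1"] y less by auto
    ultimately show "p y < p (x - 1)"
      using lm_non_crossing[OF p, of y "p (x - 1)"] lm_inv[OF p, of "x - 1"] y by force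
  qed
qed

lemma cut_congruent:
  assumes p: "lifted_matching p" and "2 * N dvd x - y" "y \<in> cuts p"
  shows "x \<in> cuts p"
  unfolding cuts_def
proof (intro CollectI allI impI)
  fix u assume "u < x"
  then have "p (u - (x - y)) < y" using cutsD[OF assms(3)] by simp
  moreover have "p u = p (u - (x - y)) + (x - y)"
    using lm_congruent[OF p, of u "u - (x - y)"] assms(2) by simp
  ultimately show "p u < x" by simp
qed

lemma cut_shift: "lifted_matching p \<Longrightarrow> x + 2 * N \<in> cuts p \<longleftrightarrow> x \<in> cuts p"
  using cut_congruent[of p "x + 2 * N" x] cut_congruent[of p x "x + 2 * N"] by auto

text \<open>Among the arcs over the gap before \<open>k\<close>, the one that starts first is
  maximal. It exists because arcs shorter than \<open>N\<close> leave only finitely many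
  candidates.\<close>

lemma covering_cut:
  assumes p: "lifted_matching p" and k: "k \<notin> cuts p"
  obtains c where "c \<in> cuts p" "c < k" "k \<le> p c"
proof -
  define S where "S = {y. y < k \<and> k \<le> p y}"
  have "S \<subseteq> {k - N..k}"
  proof
    fix y assume "y \<in> S"
    then show "y \<in> {k - N..k}" using lm_less[OF p, of y] by (auto simp: S_def)
  qed
  then have fin: "finite S" by (rule finite_subset) simp
  have "S \<noteq> {}" using k unfolding S_def cuts_def by force
  then have c: "Min S \<in> S" using fin by simp
  have "Min S \<in> cuts p"
    unfolding cuts_def
  proof (intro CollectI allI impI)
    fix y assume y: "y < Min S"
    then have "y \<notin> S" using Min_le[OF fin, of y] by auto
    have "p y \<noteq> Min S" using lm_inv[OF p, of y] y c by (auto simp: S_def)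
    moreover have "\<not> Min S < p y"
      using lm_nested[OF p, of y "Min S"] y c \<open>y \<notin> S\<close> by (auto simp: S_def)
    ultimately show "p y < Min S" by simp
  qed
  then show ?thesis using that c by (simp add: S_def)
qed

text \<open>Between two cuts the line is tiled by maximal arcs, each of which occupies an even
  number of positions.\<close>

lemma even_cut_diff:
  assumes p: "lifted_matching p" and "x \<in> cuts p" "y \<in> cuts p" "x \<le> y"
  shows "even (y - x)"
  using assms(2,4)
proof (induction "nat (y - x)" arbitrary: x rule: less_induct)
  case less
  show ?case
  proof (cases "x = y")
    case False
    then have "p x < y" using cutsD[OF assms(3)] less.prems by simp
    moreover have "p x + 1 \<in> cuts p" "x < p x" using next_cut cut_opener p less.prems by auto
    ultimately have "even (y - (p x + 1))" by (intro less.hyps) auto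
    moreover have "even ((p x + 1) - x)" using lm_odd[OF p, of x] by simp
    ultimately have "even ((y - (p x + 1)) + ((p x + 1) - x))" by (rule dvd_add)
    then show ?thesis by (simp only: diff_add_cancel add_diff_eq)
  qed simp
qed

text \<open>The two bounds by \<open>N\<close> keep the new arcs short, and their odd length comes
  from counting between the cuts \<open>b + 1\<close> and \<open>c\<close>, and between
  \<open>d + 1\<close> and \<open>a + 2 * N\<close>. The same cuts prevent crossings with old
  arcs.\<close>

lemma ex_flip:
  assumes p: "lifted_matching p" and cut: "a \<in> cuts p" "c \<in> cuts p"
    and "p a < c" "p c < a + 2 * N" "c < p a + N" "a + N < p c"
  obtains q where "lifted_matching q" "flips_at p q a c"
proof -
  define b d where "b = p a" and "d = p c"
  have ab: "a < b" and cd: "c < d" using cut_opener[OF p] cut by (auto simp: b_def d_def)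
  have ord: "b < c" "d < a + 2 * N" "c < b + N" "a + N < d" using assms(4-7) by (auto simp: b_def d_def)
  have pbd: "p a = b" "p b = a" "p c = d" "p d = c" using lm_inv[OF p] by (auto simp: b_def d_def)
  have cut': "b + 1 \<in> cuts p" "d + 1 \<in> cuts p" using next_cut[OF p] cut by (auto simp: b_def d_def)
  \<comment> \<open>\<open>R\<close> says that two indices denote the same point. The four classes
    of \<open>a\<close>, \<open>b\<close>, \<open>c\<close>, \<open>d\<close> are distinct, so the
    order of the cases in \<open>q\<close> does not matter.\<close>
  define R where "R x y \<longleftrightarrow> 2 * N dvd x - y" for x y
  have R_sub: "R x y \<longleftrightarrow> R (x + t) (y + t)" for x y t by (simp add: R_def)
  have R_sym: "R x y \<longleftrightarrow> R y x" for x y unfolding R_def by (rule dvd_diff_commute)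
  have R_trans: "R x w" if "R x y" "R y w" for x y w
    using dvd_add[of "2 * N" "x - y" "y - w"] that unfolding R_def by simp
  have R_neq: False if "R x y" "x \<noteq> y" "\<bar>x - y\<bar> < 2 * N" for x y
    using not_dvd_window[of x y] that unfolding R_def by blast
  have neq: "\<not> R a b" "\<not> R a c" "\<not> R a d" "\<not> R b c" "\<not> R b d" "\<not> R c d"
    using R_neq ab cd ord by fastforce+
  have R_period: "R (x + 2 * N) y \<longleftrightarrow> R x y" for x y
    using R_trans[of "x + 2 * N" x y] R_trans[of x "x + 2 * N" y] by (auto simp: R_def)
  define q where "q x = (if R x a then x + (d - 2 * N - a) else if R x b then x + (c - b)
    else if R x c then x - (c - b) else if R x d then x + (a + 2 * N - d) else p x)" for x
  have excl: "R x y \<Longrightarrow> R x w \<Longrightarrow> R y w" for x y w using R_trans R_sym by blast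
  have qa: "q x = x + (d - 2 * N - a)" if "R x a" for x using that by (simp add: q_def)
  have qb: "q x = x + (c - b)" if "R x b" for x using that excl neq R_sym unfolding q_def by metis
  have qc: "q x = x - (c - b)" if "R x c" for x using that excl neq R_sym unfolding q_def by metis
  have qd: "q x = x + (a + 2 * N - d)" if "R x d" for x using that excl neq R_sym unfolding q_def by metis
  have qo: "q x = p x" if "\<not> R x a" "\<not> R x b" "\<not> R x c" "\<not> R x d" for x
    using that by (simp add: q_def)
  have Rp: "R (p x) (p y)" if "R x y" for x y
    using lm_congruent[OF p, of x y] that by (simp add: R_def)
  have old: "\<not> R (p x) a \<and> \<not> R (p x) b \<and> \<not> R (p x) c \<and> \<not> R (p x) d"
    if "\<not> R x a" "\<not> R x b" "\<not> R x c" "\<not> R x d" for x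
    using that Rp[of "p x"] lm_inv[OF p, of x] pbd by metis
  have cut_R: "x \<in> cuts p" if "R x y" "y \<in> cuts p" for x y
    using cut_congruent[OF p] that unfolding R_def by blast
  have opener: "R x b \<or> R x d \<or> (\<not> R x a \<and> \<not> R x b \<and> \<not> R x c \<and> \<not> R x d)" if "x < q x" for x
    using that qa[of x] qc[of x] ord by fastforce
  have "lifted_matching q"
    unfolding lifted_matching_def
  proof (intro conjI allI)
    fix k l
    consider "R k a" | "R k b" | "R k c" | "R k d" | "\<not> R k a" "\<not> R k b" "\<not> R k c" "\<not> R k d"
      by blast
    note cases_k = this
    show "q (q k) = k"
    proof (cases rule: cases_k)
      case 1
      then have "R (k + (d - 2 * N - a)) d"
        using R_sub[of k a "d - a"] R_period[of "k + (d - 2 * N - a)" d] by (simp add: algebra_simps)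
      then show ?thesis using qa[OF 1] qd by simp
    next
      case 2
      then have "R (k + (c - b)) c" using R_sub[of k b "c - b"] by simp
      then show ?thesis using qb[OF 2] qc by simp
    next
      case 3
      then have "R (k - (c - b)) b" using R_sub[of k c "b - c"] by (simp add: algebra_simps)
      then show ?thesis using qc[OF 3] qb by simp
    next
      case 4
      then have "R (k + (a + 2 * N - d)) a"
        using R_sub[of k d "a - d"] R_period[of "k + (a - d)" a] by (simp add: algebra_simps)
      then show ?thesis using qd[OF 4] qa by simp
    next
      case 5
      then show ?thesis using qo[OF 5] qo[of "p k"] old[OF 5] lm_inv[OF p] by simp
    qed
    have par: "odd (c - b)" "odd (a + 2 * N - d)"
      using even_cut_diff[OF p cut'(1) cut(2)] even_cut_diff[OF p cut'(2), of "a + 2 * N"]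
        cut_shift[OF p, of a] cut ord by auto
    show "odd (q k - k)"
      by (cases rule: cases_k) (use par lm_odd[OF p, of k] in \<open>auto simp: qa qb qc qd qo\<close>)
    show "\<bar>q k - k\<bar> < N"
      by (cases rule: cases_k) (use ord ab cd lm_abs[OF p, of k] in \<open>auto simp: qa qb qc qd qo\<close>)
    show "q (k + 2 * N) = q k + 2 * N"
      by (cases rule: cases_k) (use lm_period[OF p, of k] in \<open>auto simp: qa qb qc qd qo R_period\<close>)
    show "\<not> (k < l \<and> l < q k \<and> q k < q l)"
    proof
      assume kl: "k < l \<and> l < q k \<and> q k < q l"
      \<comment> \<open>A new arc opens one position before a cut and ends at a cut, and no old arc
        passes over a cut. This settles all crossings of a new arc with an old one.\<close>
      have old_cut: False if "x < y" "y \<le> p x" "y \<in> cuts p" for x y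
        using cutsD[OF that(3), of x] that by simp
      have end_cut: "q x \<in> cuts p" if "R x b \<or> R x d" for x
        using that
      proof
        assume "R x b"
        then show ?thesis using qb[of x] cut_R[of "x + (c - b)" c] R_sub[of x b "c - b"] cut by simp
      next
        assume "R x d"
        moreover from this have "R (x + (a + 2 * N - d)) a"
          using R_sub[of x d "a - d"] R_period[of "x + (a - d)" a] by (simp add: algebra_simps)
        ultimately show ?thesis using qd[of x] cut_R cut by simp
      qed
      have start_cut: "x + 1 \<in> cuts p" if "R x b \<or> R x d" for x
        using that cut_R[of "x + 1" "b + 1"] cut_R[of "x + 1" "d + 1"] cut'
          R_sub[of x b 1] R_sub[of x d 1] by blast
      have k: "k < q k" and l: "l < q l" using kl by auto
      show False
      proof (cases "R k b \<or> R k d")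
        case True
        show False
        proof (cases "R l b \<or> R l d")
          case l_new: True
          consider "R k b" "R l b" | "R k d" "R l d" | "R k b" "R l d" | "R k d" "R l b"
            using True l_new by blast
          then show False
          proof cases
            case 1
            then show False using R_neq[of l k] R_trans[of l b k] R_sym[of k b] kl qb[of k] ord by simp
          next
            case 2
            then show False using R_neq[of l k] R_trans[of l d k] R_sym[of k d] kl qd[of k] ord by simp
          next
            \<comment> \<open>The residue of \<open>l\<close> leaves only
              \<open>l = k + (d - b)\<close> within reach, which lies beyond the end of the new arc
              at \<open>k\<close>.\<close>
            case 3
            then have "R l (k + (d - b))"
              using R_sub[of k b "d - b"] R_trans[of l d "k + (d - b)"] R_sym[of d "k + (d - b)"] by simp
            then show False using R_neq[of l "k + (d - b)"] kl qb[OF 3(1)] ord ab cd by simp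
          next
            case 4
            then have "R (l + (d - b)) k"
              using R_sub[of l b "d - b"] R_trans[of "l + (d - b)" d k] R_sym[of d k] by simp
            then show False using R_neq[of "l + (d - b)" k] kl qd[OF 4(1)] ord ab cd by simp
          qed
        next
          case False
          then have "q l = p l" using opener[OF l] qo by blast
          then show False using old_cut[of l "q k"] end_cut[OF True] kl by simp
        qed
      next
        case False
        then have qk: "q k = p k" using opener[OF k] qo by blast
        show False
        proof (cases "R l b \<or> R l d")
          case True
          then show False using old_cut[of k "l + 1"] start_cut[OF True] kl qk by simp
        next
          case False
          then have "q l = p l" using opener[OF l] qo by blast
          then show False using lm_non_crossing[OF p, of k l] kl qk by simp
        qed
      qed
    qed
  qed
  moreover have "flips_at p q a c"
    unfolding flips_at_def pbd
  proof (intro conjI allI impI)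
    show "q b = c" "q d = a + 2 * N" using qb[of b] qd[of d] by (auto simp: R_def)
    show "q x = p x" if "\<forall>y\<in>{a, b, c, d}. \<not> 2 * N dvd x - y" for x
      using that by (intro qo) (auto simp: R_def)
  qed (use ab cd ord in auto)
  ultimately show ?thesis using that by blast
qed

text \<open>The two chords of a flip play the same role; rotating the window lets facts about
  \<open>a\<close> be reused for \<open>c\<close>.\<close>

lemma flips_at_rotate:
  assumes p: "lifted_matching p" and q: "lifted_matching q" and "flips_at p q a c"
  shows "flips_at p q c (a + 2 * N)"
proof -
  note flip = flips_atD[OF assms]
  have "2 * N dvd (x - a) + (- 1) * (2 * N) \<longleftrightarrow> 2 * N dvd x - a"
    "2 * N dvd (x - p a) + (- 1) * (2 * N) \<longleftrightarrow> 2 * N dvd x - p a" for x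
    by (rule dvd_add_times_triv_right_iff)+
  then have per: "2 * N dvd x - (a + 2 * N) \<longleftrightarrow> 2 * N dvd x - a"
    "2 * N dvd x - (p a + 2 * N) \<longleftrightarrow> 2 * N dvd x - p a" for x
    by (simp_all add: algebra_simps)
  show ?thesis
    unfolding flips_at_def lm_period[OF p] lm_period[OF q] flip(5,6)
  proof (intro conjI allI impI)
    show "q x = p x" if "\<forall>y\<in>{c, p c, a + 2 * N, p a + 2 * N}. \<not> 2 * N dvd x - y" for x
      by (rule flip(11)) (use that per in auto)
  qed (use flip(1-4) in auto)
qed

text \<open>An arc of \<open>p\<close> over \<open>a\<close> would survive the flip and then, by
  nesting in \<open>q\<close>, also enclose the new arcs ending at \<open>a\<close> and at
  \<open>c\<close>. Together with \<open>p c < c + N\<close> this makes it longer than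
  \<open>N\<close>.\<close>

lemma flips_at_cut_left:
  assumes p: "lifted_matching p" and q: "lifted_matching q" and "flips_at p q a c"
  shows "a \<in> cuts p"
  unfolding cuts_def
proof (intro CollectI allI impI, rule ccontr)
  note flip = flips_atD[OF assms]
  fix y assume y: "y < a" "\<not> p y < a"
  have "p y \<noteq> a" using lm_inv[OF p, of y] y flip(1) by auto
  then have "a < p y" using y by simp
  then have "p a < p y" using lm_nested[OF p, of y a] y by simp
  have near: "p a < a + N" "p c < c + N" using lm_less[OF p] by auto
  \<comment> \<open>Were \<open>y\<close> one of the four points, it would be shifted left by at
    least a full period, and its partner would lie before \<open>a\<close>.\<close>
  have "\<not> 2 * N dvd y - x" if "x \<in> {a, p a, c, p c}" for x
  proof
    assume dvd: "2 * N dvd y - x"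
    then have "p y = p x + (y - x)" using lm_congruent[OF p] by simp
    moreover have "y - x \<le> - (2 * N)"
      using zdvd_imp_le[of "2 * N" "x - y"] dvd dvd_diff_commute[of "2 * N" y x] that y flip(1-4) by auto
    ultimately show False
      using that y flip(1-4) lm_inv[OF p, of a] lm_inv[OF p, of c] by auto
  qed
  then have "q y = p y" by (intro flip(11)) blast
  moreover have "y < p c - 2 * N"
    using lm_nested[OF q, of y a] y \<open>q y = p y\<close> \<open>a < p y\<close> flip(8) by simp
  moreover have "c < p y"
    using lm_nested[OF q, of y "p a"] y \<open>q y = p y\<close> \<open>p a < p y\<close> flip(1,5) by simp
  ultimately show False using lm_less[OF p, of y] near by simp
qed

lemma flips_at_cuts:
  assumes p: "lifted_matching p" and q: "lifted_matching q" and "flips_at p q a c"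
  shows "a \<in> cuts p" "c \<in> cuts p" "p a \<in> cuts q" "p c \<in> cuts q" "c + 1 \<in> cuts q" "a + 1 \<in> cuts q"
proof -
  note flip = flips_atD[OF assms]
  note sym = flips_at_sym[OF assms]
  show "a \<in> cuts p" "c \<in> cuts p"
    using flips_at_cut_left[OF assms] flips_at_cut_left[OF p q flips_at_rotate[OF assms]] by auto
  show *: "p a \<in> cuts q" "p c \<in> cuts q"
    using flips_at_cut_left[OF q p sym] flips_at_cut_left[OF q p flips_at_rotate[OF q p sym]] by auto
  show "c + 1 \<in> cuts q" using next_cut[OF q *(1)] flip(5) by simp
  have "(a + 1) + 2 * N \<in> cuts q" using next_cut[OF q *(2)] flip(6) by (simp add: algebra_simps)
  then show "a + 1 \<in> cuts q" using cut_shift[OF q] by blast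
qed

section \<open>Symmetric and asymmetric central faces\<close>

definition symmetric_cuts :: "(int \<Rightarrow> int) \<Rightarrow> bool" where
  "symmetric_cuts p \<longleftrightarrow> (\<forall>x\<in>cuts p. x + N \<in> cuts p)"

lemma symmetric_cutsD:
  assumes p: "lifted_matching p" and "symmetric_cuts p" "x \<in> cuts p"
  shows "x + N \<in> cuts p" "x - N \<in> cuts p"
proof -
  show *: "x + N \<in> cuts p" using assms by (simp add: symmetric_cuts_def)
  have "(x - N) + 2 * N = x + N" by simp
  then show "x - N \<in> cuts p" using * cut_shift[OF p, of "x - N"] by (simp only:)
qed

text \<open>The cut after either arc, shifted by \<open>N\<close>, is again a cut, so neither of the
  two arcs can outlast the other.\<close>

lemma symmetric_cuts_arc:
  assumes p: "lifted_matching p" and "symmetric_cuts p" "x \<in> cuts p"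
  shows "p (x + N) = p x + N"
proof -
  note sym = symmetric_cutsD[OF p assms(2)]
  have "p (x + N) < p x + 1 + N"
    using cutsD[OF sym(1)[OF next_cut[OF p assms(3)]], of "x + N"] cut_opener[OF p assms(3)] by simp
  moreover have "p x < p (x + N) + 1 - N"
    using cutsD[OF sym(2)[OF next_cut[OF p sym(1)[OF assms(3)]]], of x]
      cut_opener[OF p sym(1)[OF assms(3)]] by simp
  ultimately show ?thesis by simp
qed

text \<open>Shifted cuts of \<open>q\<close> must not fall under the two new arcs, which aligns the
  ends. In contrapositive form: flipping a pair that is not antipodal leaves an asymmetric central
  face.\<close>

lemma flip_symmetric_cuts:
  assumes p: "lifted_matching p" and q: "lifted_matching q" and "flips_at p q a c" "symmetric_cuts q"
  shows "c = a + N" "p c = p a + N"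
proof -
  define b d where "b = p a" and "d = p c"
  note flip = flips_atD[OF assms(1-3), folded b_def d_def]
  note cut = flips_at_cuts[OF assms(1-3), folded b_def d_def]
  note sym = symmetric_cutsD[OF q assms(4)]
  have near: "b < a + N" "d < c + N" using lm_less[OF p] unfolding b_def d_def by auto
  have "\<not> b < d - N"
    using cutsD[OF sym(2)[OF cut(4)], of b] flip(5) near by auto
  then have "d < b + N + 1" by simp
  moreover have "b + N < d + 1"
  proof -
    have "\<not> (d < b + N \<and> b + N \<le> a + 2 * N)" using cutsD[OF sym(1)[OF cut(3)], of d] flip(6) by auto
    then show ?thesis using near by simp
  qed
  ultimately have "d = b + N" by simp
  moreover have "c = a + N"
  proof -
    have "\<not> (d < c + 1 + N \<and> c + 1 + N \<le> a + 2 * N)" using cutsD[OF sym(1)[OF cut(5)], of d] flip(6) by auto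
    moreover have "\<not> (b < a + 1 + N \<and> a + 1 + N \<le> c)" using cutsD[OF sym(1)[OF cut(6)], of b] flip(5) by auto
    ultimately show ?thesis using near flip(1) by simp
  qed
  ultimately show "c = a + N" "p c = p a + N" by (auto simp: b_def d_def)
qed

text \<open>If \<open>x\<close> is a cut but \<open>x + n\<close> lies inside a maximal arc, then this arc can be flipped with either of
  the two maximal arcs meeting at \<open>x\<close>, and neither pair is antipodal.\<close>

lemma asymmetric_two_flips:
  assumes p: "lifted_matching p" and "\<not> symmetric_cuts p"
  obtains q q' a c a' c' where "q \<noteq> q'" "lifted_matching q" "lifted_matching q'" "flips_at p q a c" "flips_at p q' a' c'"
    "\<not> symmetric_cuts q" "\<not> symmetric_cuts q'"
proof -
  obtain x where x: "x \<in> cuts p" "x + N \<notin> cuts p" using assms(2) by (auto simp: symmetric_cuts_def)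
  obtain c where c: "c \<in> cuts p" "c < x + N" "x + N \<le> p c" using covering_cut[OF p x(2)] .
  have near: "p c < c + N" "p x < x + N" using lm_less[OF p] by auto
  have xc: "p x < c" using cutsD[OF c(1), of x] near c by simp
  \<comment> \<open>Parity excludes the borderline cases \<open>p c = x + N\<close> and
    \<open>c = x - 1 + N\<close>, in which a new edge would be a diameter.\<close>
  have "even (c - x)" using even_cut_diff[OF p x(1) c(1)] xc cut_opener[OF p x(1)] by simp
  moreover have "odd (p c - c)" using lm_odd[OF p] .
  ultimately have "odd ((p c - c) + (c - x))" by simp
  then have "odd (p c - x)" by simp
  then have "p c \<noteq> x + N" using even_n by auto
  then have dx: "x + N < p c" using c by simp
  obtain q where q: "lifted_matching q" "flips_at p q x c"
    using ex_flip[OF p x(1) c(1) xc] near c dx cut_opener[OF p x(1)] by auto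
  \<comment> \<open>The start of the maximal arc that ends just before the cut
    \<open>x\<close>.\<close>
  define a where "a = p (x - 1)"
  have pa: "p a = x - 1" using lm_inv[OF p] by (simp add: a_def)
  have a: "a \<in> cuts p" "a < x - 1" using prev_cut[OF p x(1)] by (auto simp: a_def)
  have "c < a + 2 * N" using lm_greater[OF p, of "x - 1"] c unfolding a_def by simp
  moreover have "a + 2 * N \<in> cuts p" using a cut_shift[OF p] by simp
  ultimately have "p c < a + 2 * N" using cutsD by blast
  have "c \<noteq> x - 1 + N" using \<open>even (c - x)\<close> even_n by auto
  obtain q' where q': "lifted_matching q'" "flips_at p q' a c"
    using ex_flip[OF p a(1) c(1)] pa xc cut_opener[OF p x(1)] \<open>p c < a + 2 * N\<close> \<open>c \<noteq> x - 1 + N\<close> c dx a by auto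
  show ?thesis
  proof (rule that[OF _ q(1) q'(1) q(2) q'(2)])
    show "q \<noteq> q'"
      using flips_atD(7)[OF p q] flips_atD(7)[OF p q'] pa cut_opener[OF p x(1)] by auto
    show "\<not> symmetric_cuts q" using flip_symmetric_cuts(1)[OF p q] c by auto
    \<comment> \<open>A symmetric result would force \<open>c = x + N\<close> in the first flip and
      \<open>p c + 1 = x + N\<close> in the second; neither is possible, as \<open>x + N\<close>
      lies under the arc from \<open>c\<close> and is no cut.\<close>
    show "\<not> symmetric_cuts q'"
      using flip_symmetric_cuts(2)[OF p q'] next_cut[OF p c(1)] pa x by auto
  qed
qed

section \<open>Depth of a point below the central face\<close>

definition depth :: "(int \<Rightarrow> int) \<Rightarrow> int \<Rightarrow> nat" where
  "depth p k = card {y. y < k \<and> k < p y}"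

lemma finite_depth: "lifted_matching p \<Longrightarrow> finite {y. y < k \<and> k < p y}"
proof (rule finite_subset)
  assume p: "lifted_matching p"
  show "{y. y < k \<and> k < p y} \<subseteq> {k - N..k}"
    using lm_less[OF p] by (auto intro: less_imp_le simp: diff_le_eq) (smt (verit, best))
qed simp

lemma antipodal_flip:
  assumes p: "lifted_matching p" and "symmetric_cuts p" and a: "a \<in> cuts p"
  obtains q where "lifted_matching q" "flips_at p q a (a + N)"
proof (rule ex_flip[OF p a])
  show "a + N \<in> cuts p" using symmetric_cutsD[OF p assms(2) a] by simp
  show "p a < a + N" "p (a + N) < a + 2 * N" "a + N < p a + N" "a + N < p (a + N)"
    using symmetric_cuts_arc[OF p assms(2) a] lm_less[OF p, of a] cut_opener[OF p a] by auto
qed (rule that)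

text \<open>The new arcs run from \<open>p a\<close> to \<open>a + N\<close> and from
  \<open>p a + N\<close> to \<open>a + 2 * N\<close>, so none covers \<open>k\<close>: it loses the
  arc from \<open>a\<close> and gains nothing.\<close>

lemma antipodal_flip_depth:
  assumes p: "lifted_matching p" and "symmetric_cuts p" and a: "a \<in> cuts p" and k: "a < k" "k < p a"
    and q: "lifted_matching q" "flips_at p q a (a + N)"
  shows "q k = p k" "q (k + N) = p (k + N)" "depth q k < depth p k"
proof -
  note flip = flips_atD[OF p q]
  have arc: "p (a + N) = p a + N" using symmetric_cuts_arc[OF assms(1-3)] .
  have near: "p a < a + N" using lm_less[OF p] .
  show "q k = p k" "q (k + N) = p (k + N)"
    using flip(12)[of k] flip(12)[of "k + N"] k near arc by auto
  have "q y = p y" if y: "y < k" "k < q y" for y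
  proof -
    have "k < y + N" using lm_less[OF q(1), of y] y by simp
    consider "a < y" | "y = a" | "y < a" by linarith
    then show ?thesis
    proof cases
      case 1
      then show ?thesis using flip(12)[of y] y k near arc by simp
    next
      case 2
      then show ?thesis using flip(4,8) y by simp
    next
      case 3
      have per: "q (y + 2 * N) = q y + 2 * N" "p (y + 2 * N) = p y + 2 * N"
        using lm_period p q by auto
      have "y + 2 * N \<noteq> p (a + N)" using flip(6) per y k by auto
      then show ?thesis using flip(12)[of "y + 2 * N"] per 3 \<open>k < y + N\<close> k near by simp
    qed
  qed
  then have "{y. y < k \<and> k < q y} \<subseteq> {y. y < k \<and> k < p y}" by auto
  moreover have "a \<in> {y. y < k \<and> k < p y}" "a \<notin> {y. y < k \<and> k < q y}"
    using k flip(4,8) by auto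
  ultimately have "{y. y < k \<and> k < q y} \<subset> {y. y < k \<and> k < p y}" by blast
  then show "depth q k < depth p k"
    unfolding depth_def using finite_depth[OF p] by (rule psubset_card_mono[rotated])
qed

section \<open>Symmetric lifts\<close>

definition symmetric_lift :: "(int \<Rightarrow> int) \<Rightarrow> bool" where
  "symmetric_lift p \<longleftrightarrow> lifted_matching p \<and> (\<forall>k. p (k + N) = p k + N)"

lemma symmetric_lift_lm: "symmetric_lift p \<Longrightarrow> lifted_matching p"
  by (simp add: symmetric_lift_def)

lemma symmetric_lift_period_mult: "symmetric_lift p \<Longrightarrow> p (k + N * j) = p k + N * j"
  unfolding symmetric_lift_def by (blast intro: translation_mult)

lemma symmetric_lift_congruent:
  assumes "symmetric_lift p" "N dvd x - y"
  shows "p x = p y + (x - y)"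
proof -
  obtain j where "x - y = N * j" using assms(2) by (auto elim: dvdE)
  then have "x = y + N * j" by simp
  then show ?thesis using symmetric_lift_period_mult[OF assms(1), of y j] by simp
qed

lemma symmetric_lift_cuts:
  assumes "symmetric_lift p"
  shows "symmetric_cuts p"
  unfolding symmetric_cuts_def cuts_def
proof (intro ballI CollectI allI impI)
  fix x y assume "x \<in> {x. \<forall>y<x. p y < x}" "y < x + N"
  then have "p (y - N) < x" by simp
  moreover have "p y = p (y - N) + N" using assms by (metis symmetric_lift_def diff_add_cancel)
  ultimately show "p y < x + N" by simp
qed

lemma symmetric_lift_cut_congruent:
  assumes p: "symmetric_lift p" and "N dvd x - y" "y \<in> cuts p"
  shows "x \<in> cuts p"
  unfolding cuts_def
proof (intro CollectI allI impI)
  fix u assume "u < x"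
  then have "p (u - (x - y)) < y" using cutsD[OF assms(3)] by simp
  moreover have "p u = p (u - (x - y)) + (x - y)"
    using symmetric_lift_congruent[OF p, of u "u - (x - y)"] assms(2) by simp
  ultimately show "p u < x" by simp
qed

text \<open>The flip of the antipodal arcs starting at \<open>a\<close> and \<open>a + n\<close>, written modulo \<open>n\<close>.\<close>

definition turn :: "(int \<Rightarrow> int) \<Rightarrow> int \<Rightarrow> int \<Rightarrow> int" where
  "turn p a x = (if N dvd x - a then x + (p a - a - N) else if N dvd x - p a then x + (a + N - p a) else p x)"

lemma turn_congruent:
  assumes p: "symmetric_lift p" and "N dvd a' - a"
  shows "turn p a' = turn p a"
proof -
  have pa: "p a' = p a + (a' - a)" using symmetric_lift_congruent[OF assms] .
  have "N dvd x - a' \<longleftrightarrow> N dvd x - a" "N dvd x - p a' \<longleftrightarrow> N dvd x - p a" for x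
    using dvd_diff_left_iff[OF assms(2), of "x - a"] dvd_diff_left_iff[OF assms(2), of "x - p a"]
    by (simp_all add: pa algebra_simps)
  then show ?thesis by (simp add: turn_def fun_eq_iff pa)
qed

lemma N_dvd_cases:
  assumes "N dvd t"
  shows "2 * N dvd t \<or> 2 * N dvd t - N"
proof -
  obtain j where j: "t = N * j" using assms by (auto elim: dvdE)
  show ?thesis
  proof (cases "even j")
    case True
    then show ?thesis using j by (auto elim: evenE)
  next
    case False
    then obtain i where "j = 2 * i + 1" by (auto elim: oddE)
    then have "t - N = 2 * N * i" using j by (simp add: algebra_simps)
    then show ?thesis by simp
  qed
qed

text \<open>The arc at the cut \<open>a + N\<close> is the shift of the one at \<open>a\<close>.
  Since \<open>c < p a + N\<close> and \<open>a + N < p c\<close>, neither of the cuts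
  \<open>c\<close> and \<open>a + N\<close> can precede the other, so the flipped pair is
  antipodal.\<close>

lemma symmetric_flip:
  assumes p: "symmetric_lift p" and q: "lifted_matching q" and flips: "flips_at p q a c"
  shows "a \<in> cuts p" "c = a + N" "q = turn p a" "symmetric_lift q" "N dvd q x - p x"
proof -
  note lmp = symmetric_lift_lm[OF p]
  note flip = flips_atD[OF lmp q flips]
  note cut = flips_at_cuts[OF lmp q flips]
  show "a \<in> cuts p" by fact
  have aN: "a + N \<in> cuts p" using symmetric_cutsD[OF lmp symmetric_lift_cuts[OF p] cut(1)] by simp
  have arc: "p (a + N) = p a + N" using p by (simp add: symmetric_lift_def)
  show c: "c = a + N"
    using cutsD[OF aN, of c] cutsD[OF cut(2), of "a + N"] flip(9,10) arc by force
  have d: "p c = p a + N" using c arc by simp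
  have qx: "q x = turn p a x" for x
  proof -
    consider "N dvd x - a" | "\<not> N dvd x - a" "N dvd x - p a" | "\<not> N dvd x - a" "\<not> N dvd x - p a" by blast
    then show ?thesis
    proof cases
      case 1
      then consider "2 * N dvd x - a" | "2 * N dvd x - (a + N)"
        using N_dvd_cases by (metis diff_diff_eq)
      then show ?thesis
        by cases (use lm_congruent[OF q] flip(7,8) c d 1 in \<open>auto simp: turn_def\<close>)
    next
      case 2
      then consider "2 * N dvd x - p a" | "2 * N dvd x - (p a + N)"
        using N_dvd_cases by (metis diff_diff_eq)
      then show ?thesis
        by cases (use lm_congruent[OF q] flip(5,6) c d 2 in \<open>auto simp: turn_def\<close>)
    next
      case 3
      have "N dvd x - y" if "2 * N dvd x - y" for y using that dvd_mult_right by blast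
      moreover have "N dvd x - (y + N) \<longleftrightarrow> N dvd x - y" for y
        using dvd_diff_left_iff[of N N "x - y"] by (simp add: algebra_simps)
      ultimately have "q x = p x" using 3 c d by (intro flip(11)) auto
      then show ?thesis using 3 by (simp add: turn_def)
    qed
  qed
  then show "q = turn p a" by (rule ext)
  have per: "N dvd x + N - y \<longleftrightarrow> N dvd x - y" for x y
    using dvd_add_left_iff[of N N "x - y"] by (simp add: algebra_simps)
  have "q (x + N) = q x + N" for x
    using p unfolding qx turn_def per by (simp add: symmetric_lift_def)
  then show "symmetric_lift q" using q by (simp add: symmetric_lift_def)
  show "N dvd q x - p x"
    using symmetric_lift_congruent[OF p, of x a] symmetric_lift_congruent[OF p, of x "p a"] lm_inv[OF lmp]
    unfolding qx turn_def by auto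
qed

lemma symmetric_turn:
  assumes p: "symmetric_lift p" and a: "a \<in> cuts p"
  shows "lifted_matching (turn p a)" "flips_at p (turn p a) a (a + N)" "symmetric_lift (turn p a)"
proof -
  obtain q where q: "lifted_matching q" "flips_at p q a (a + N)"
    using antipodal_flip[OF symmetric_lift_lm[OF p] symmetric_lift_cuts[OF p] a] .
  with symmetric_flip[OF p q] show "lifted_matching (turn p a)" "flips_at p (turn p a) a (a + N)"
    "symmetric_lift (turn p a)" by simp_all
qed

lemma turn_turn:
  assumes p: "symmetric_lift p" and a: "a \<in> cuts p"
  shows "p a \<in> cuts (turn p a)" "turn (turn p a) (p a) = p" "turn p a (p a) = a + N"
proof -
  note lmp = symmetric_lift_lm[OF p]
  note t = symmetric_turn[OF assms]
  note s = symmetric_flip[OF t(3) lmp flips_at_sym[OF lmp t(1,2)]]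
  show "p a \<in> cuts (turn p a)" "turn (turn p a) (p a) = p" using s by auto
  show "turn p a (p a) = a + N" using flips_atD(5)[OF lmp t(1,2)] .
qed

text \<open>The distance from the central face to the face meeting the circle just before \<open>z 0\<close>; it measures the
  depth in the component tree.\<close>

definition rank :: "(int \<Rightarrow> int) \<Rightarrow> nat" where
  "rank p = card {y. y < 0 \<and> 0 \<le> p y}"

lemma finite_rank: "lifted_matching p \<Longrightarrow> finite {y. y < 0 \<and> 0 \<le> p y}"
proof (rule finite_subset)
  assume p: "lifted_matching p"
  show "{y. y < 0 \<and> 0 \<le> p y} \<subseteq> {- N..0}"
  proof
    fix y assume "y \<in> {y. y < 0 \<and> 0 \<le> p y}"
    then show "y \<in> {- N..0}" using lm_less[OF p, of y] by auto
  qed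
qed simp

lemma congruent_less:
  assumes "N dvd x - y" "x < y + N"
  shows "x \<le> y"
proof (rule ccontr)
  assume "\<not> x \<le> y"
  then have "N \<le> x - y" using assms(1) by (intro zdvd_imp_le) auto
  then show False using assms by simp
qed

text \<open>Being shorter than \<open>N\<close>, the arc from \<open>a\<close> is the only one of
  its shifts over the gap before 0. It is replaced by shifts of the arc from \<open>p a - N\<close>
  to \<open>a\<close>, none of which covers that gap because \<open>a < 0\<close> and
  \<open>0 \<le> p a\<close>.\<close>

lemma rank_turn_down:
  assumes p: "symmetric_lift p" and a: "a \<in> cuts p" "a < 0" "0 \<le> p a"
  shows "Suc (rank (turn p a)) = rank p"
proof -
  note lmp = symmetric_lift_lm[OF p]
  have near: "p a < a + N" using lm_less[OF lmp] .
  define W where "W p = {y. y < 0 \<and> 0 \<le> p y}" for p :: "int \<Rightarrow> int"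
  have "y \<in> W (turn p a) \<longleftrightarrow> y \<in> W p - {a}" for y
  proof -
    consider "N dvd y - a" | "\<not> N dvd y - a" "N dvd y - p a" | "\<not> N dvd y - a" "\<not> N dvd y - p a" by blast
    then show ?thesis
    proof cases
      case 1
      have "p y = p a + (y - a)" using symmetric_lift_congruent[OF p 1] .
      moreover have "y < 0 \<Longrightarrow> y \<le> a" using congruent_less[OF 1] near a by simp
      moreover have "y < a \<Longrightarrow> y \<le> a - N"
        using congruent_less[of y "a - N"] 1 dvd_add_left_iff[of N N "y - a"] by (simp add: algebra_simps)
      ultimately show ?thesis using 1 near a by (auto simp: W_def turn_def)
    next
      case 2
      have "p y = a + (y - p a)" using symmetric_lift_congruent[OF p 2(2)] lm_inv[OF lmp] by simp
      moreover have "y < 0 \<Longrightarrow> y \<le> p a - N"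
        using congruent_less[of y "p a - N"] 2 dvd_add_left_iff[of N N "y - p a"] a by (simp add: algebra_simps)
      moreover have "a < p a" using a by simp
      ultimately show ?thesis using 2 near a by (auto simp: W_def turn_def)
    next
      case 3
      then show ?thesis by (auto simp: W_def turn_def)
    qed
  qed
  then have "W (turn p a) = W p - {a}" by blast
  moreover have "a \<in> W p" "finite (W p)" using a finite_rank[OF lmp] by (auto simp: W_def)
  ultimately show ?thesis
    using card_Suc_Diff1[of "W p" a] by (simp add: rank_def W_def[symmetric])
qed

lemma rank_turn_cases:
  assumes p: "symmetric_lift p" and a: "a \<in> cuts p"
  obtains (up) "rank (turn p a) = Suc (rank p)"
    | (down) a' where "a' \<in> cuts p" "a' < 0" "0 \<le> p a'" "turn p a = turn p a'" "Suc (rank (turn p a)) = rank p"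
proof -
  \<comment> \<open>Among the shifts of the arc by multiples of \<open>N\<close>, this is the one
    ending in \<open>{0..<N}\<close>.\<close>
  define a' where "a' = a - N * (p a div N)"
  have dvd: "N dvd a' - a" by (simp add: a'_def)
  have a': "a' \<in> cuts p" using symmetric_lift_cut_congruent[OF p dvd a] .
  have eq: "turn p a' = turn p a" using turn_congruent[OF p dvd] .
  have "p a' = p a mod N"
    using symmetric_lift_congruent[OF p dvd] by (simp add: a'_def minus_mult_div_eq_mod)
  then have pa': "0 \<le> p a'" "p a' < N" using N_pos by auto
  show ?thesis
  proof (cases "a' < 0")
    case True
    then show ?thesis using down[of a'] a' pa' eq rank_turn_down[OF p a'] by simp
  next
    case False
    \<comment> \<open>Here the turn creates an arc over the gap before 0, so it is the reverse turn
      that lowers the rank.\<close>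
    define q where "q = turn p a'"
    have q: "symmetric_lift q" using symmetric_turn[OF p a'] by (simp add: q_def)
    note t = turn_turn[OF p a', folded q_def]
    have dvd': "N dvd (p a' - N) - p a'" by simp
    have "q (p a' - N) = a'" using symmetric_lift_congruent[OF q dvd'] t(3) by simp
    moreover have "p a' - N \<in> cuts q" using symmetric_lift_cut_congruent[OF q dvd' t(1)] .
    ultimately have "Suc (rank (turn q (p a' - N))) = rank q"
      using rank_turn_down[OF q, of "p a' - N"] False pa' by simp
    then have "Suc (rank p) = rank q" using turn_congruent[OF q dvd'] t(2) by simp
    then show ?thesis using up eq q_def by simp
  qed
qed

text \<open>Only one maximal arc lies over the gap before 0; turning it leads to the parent in the
  tree.\<close>

lemma lower_flip_unique:
  assumes p: "symmetric_lift p" and "a \<in> cuts p" "a' \<in> cuts p"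
    and "rank (turn p a) < rank p" "rank (turn p a') < rank p"
  shows "turn p a = turn p a'"
proof -
  obtain b where b: "b \<in> cuts p" "b < 0" "0 \<le> p b" "turn p a = turn p b"
    using rank_turn_cases[OF p assms(2)] assms(4) by (metis less_Suc_eq not_less_iff_gr_or_eq)
  obtain b' where b': "b' \<in> cuts p" "b' < 0" "0 \<le> p b'" "turn p a' = turn p b'"
    using rank_turn_cases[OF p assms(3)] assms(5) by (metis less_Suc_eq not_less_iff_gr_or_eq)
  have "b = b'" using cutsD[OF b(1), of b'] cutsD[OF b'(1), of b] b b' by force
  then show ?thesis using b b' by simp
qed

section \<open>Components of the flip relation\<close>

definition flip_rel :: "((int \<Rightarrow> int) \<times> (int \<Rightarrow> int)) set" where
  "flip_rel = {(p, q). lifted_matching p \<and> lifted_matching q \<and> (\<exists>a c. flips_at p q a c)}"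

lemma flip_relI: "lifted_matching p \<Longrightarrow> lifted_matching q \<Longrightarrow> flips_at p q a c \<Longrightarrow> (p, q) \<in> flip_rel"
  by (auto simp: flip_rel_def)

lemma flip_rel_sym: "sym flip_rel"
proof (rule symI)
  fix p q assume "(p, q) \<in> flip_rel"
  then obtain a c where pq: "lifted_matching p" "lifted_matching q" "flips_at p q a c"
    by (auto simp: flip_rel_def)
  show "(q, p) \<in> flip_rel" using flip_relI[OF pq(2,1) flips_at_sym[OF pq]] .
qed

lemma flip_rel_lm:
  assumes "(p, q) \<in> flip_rel\<^sup>*" "lifted_matching p"
  shows "lifted_matching q"
  using assms by (induction rule: rtrancl_induct) (auto simp: flip_rel_def)

text \<open>Antipodal flips keep every partner modulo \<open>N\<close>, so the projection to the
  quotient circle is an invariant of the component.\<close>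

lemma flip_rel_symmetric:
  assumes "(p, q) \<in> flip_rel\<^sup>*" "symmetric_lift p"
  shows "symmetric_lift q \<and> (\<forall>k. N dvd q k - p k)"
  using assms
proof (induction rule: rtrancl_induct)
  case (step q q')
  then obtain a c where q': "lifted_matching q'" "flips_at q q' a c" by (auto simp: flip_rel_def)
  have q: "symmetric_lift q" using step by simp
  have "N dvd q' k - p k" for k
  proof -
    have "N dvd (q' k - q k) + (q k - p k)"
      using symmetric_flip(5)[OF q q', of k] step by (intro dvd_add) auto
    then show ?thesis by simp
  qed
  then show ?case using symmetric_flip(4)[OF q q'] by simp
qed simp

lemma flip_rel_turn: "symmetric_lift p \<Longrightarrow> a \<in> cuts p \<Longrightarrow> (p, turn p a) \<in> flip_rel"
  by (rule flip_relI[OF symmetric_lift_lm symmetric_turn(1,2)])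

text \<open>As long as the central face is symmetric, the maximal arc over \<open>k\<close> can be
  flipped with its antipode, which lowers the depth. The partners of \<open>k\<close> and
  \<open>k + N\<close> stay fixed, so an asymmetry at \<open>k\<close> survives.\<close>

lemma uncover:
  assumes "lifted_matching p"
  shows "\<exists>q. (p, q) \<in> flip_rel\<^sup>* \<and> lifted_matching q \<and> q k = p k \<and> q (k + N) = p (k + N)
    \<and> (symmetric_cuts q \<longrightarrow> \<not> (\<exists>a\<in>cuts q. a < k \<and> k < q a))"
  using assms
proof (induction "depth p k" arbitrary: p rule: less_induct)
  case less
  show ?case
  proof (cases "symmetric_cuts p \<and> (\<exists>a\<in>cuts p. a < k \<and> k < p a)")
    case False
    then show ?thesis using less.prems by blast
  next
    case True
    then obtain a where a: "symmetric_cuts p" "a \<in> cuts p" "a < k" "k < p a" by blast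
    obtain q where q: "lifted_matching q" "flips_at p q a (a + N)"
      using antipodal_flip[OF less.prems a(1,2)] .
    note depth = antipodal_flip_depth[OF less.prems a q]
    obtain q' where q': "(q, q') \<in> flip_rel\<^sup>*" "lifted_matching q'" "q' k = q k" "q' (k + N) = q (k + N)"
      "symmetric_cuts q' \<longrightarrow> \<not> (\<exists>a\<in>cuts q'. a < k \<and> k < q' a)"
      using less.hyps[OF depth(3) q(1)] by blast
    have "(p, q') \<in> flip_rel\<^sup>*"
      using flip_relI[OF less.prems q] q'(1) by (rule converse_rtrancl_into_rtrancl)
    then show ?thesis using q' depth(1,2) by auto
  qed
qed

lemma asymmetric_reaches_asymmetric_cuts:
  assumes p: "lifted_matching p" and "p (k + N) \<noteq> p k + N"
  obtains q where "(p, q) \<in> flip_rel\<^sup>*" "lifted_matching q" "\<not> symmetric_cuts q"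
proof -
  obtain q where q: "(p, q) \<in> flip_rel\<^sup>*" "lifted_matching q" "q (k + N) \<noteq> q k + N"
    "symmetric_cuts q \<longrightarrow> \<not> (\<exists>a\<in>cuts q. a < k \<and> k < q a)"
    using uncover[OF p, of k] assms(2) by metis
  have "\<not> symmetric_cuts q"
  proof
    assume sym: "symmetric_cuts q"
    then have "k \<notin> cuts q" using symmetric_cuts_arc[OF q(2)] q(3) by blast
    then obtain a where a: "a \<in> cuts q" "a < k" "k \<le> q a" using covering_cut[OF q(2)] by blast
    \<comment> \<open>Once uncovered, \<open>k\<close> is an end of a maximal arc, and in a
      symmetric central face such an arc has an antipodal partner.\<close>
    then have "k = q a" using q(4) sym by force
    moreover have "q (q a + N) = a + N"
      using symmetric_cuts_arc[OF q(2) sym a(1)] lm_inv[OF q(2), of "a + N"] by simp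
    ultimately show False using q(3) lm_inv[OF q(2), of a] by simp
  qed
  then show ?thesis using that q by blast
qed

section \<open>Roots of the symmetric components\<close>

lemma reaches_root:
  assumes "symmetric_lift p"
  shows "\<exists>r. (p, r) \<in> flip_rel\<^sup>* \<and> symmetric_lift r \<and> 0 \<in> cuts r"
  using assms
proof (induction "rank p" arbitrary: p rule: less_induct)
  case less
  show ?case
  proof (cases "0 \<in> cuts p")
    case False
    obtain c where c: "c \<in> cuts p" "c < 0" "0 \<le> p c"
      using covering_cut[OF symmetric_lift_lm[OF less.prems] False] .
    have "rank (turn p c) < rank p" using rank_turn_down[OF less.prems c] by simp
    then obtain r where r: "(turn p c, r) \<in> flip_rel\<^sup>*" "symmetric_lift r" "0 \<in> cuts r"
      using less.hyps symmetric_turn(3)[OF less.prems c(1)] by blast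
    have "(p, r) \<in> flip_rel\<^sup>*"
      using flip_rel_turn[OF less.prems c(1)] r(1) by (rule converse_rtrancl_into_rtrancl)
    then show ?thesis using r by blast
  qed (use less.prems in blast)
qed

text \<open>Cuts at 0 and \<open>N\<close> close off one period, so a root restricts to a matching
  of \<open>{0..<N}\<close> on the line.\<close>

lemma root_range:
  assumes r: "symmetric_lift r" "0 \<in> cuts r" and k: "0 \<le> k" "k < N"
  shows "0 \<le> r k" "r k < N"
proof -
  note lmr = symmetric_lift_lm[OF r(1)]
  show "0 \<le> r k" using cutsD[OF r(2), of "r k"] lm_inv[OF lmr, of k] k by force
  have "N \<in> cuts r" using symmetric_lift_cut_congruent[OF r(1), of N 0] r(2) by simp
  then show "r k < N" using cutsD k by blast
qed

lemma symmetric_lift_eqI: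
  assumes "symmetric_lift p" "symmetric_lift q" "\<And>k. 0 \<le> k \<Longrightarrow> k < N \<Longrightarrow> p k = q k"
  shows "p = q"
proof
  fix k
  have "N dvd k - k mod N" by (simp add: minus_mod_eq_mult_div)
  then show "p k = q k"
    using symmetric_lift_congruent[OF assms(1), of k "k mod N"] symmetric_lift_congruent[OF assms(2), of k "k mod N"]
      assms(3)[of "k mod N"] N_pos by simp
qed

lemma root_unique:
  assumes "symmetric_lift r" "symmetric_lift r'" "0 \<in> cuts r" "0 \<in> cuts r'" "\<And>k. N dvd r k - r' k"
  shows "r = r'"
proof (rule symmetric_lift_eqI[OF assms(1,2)])
  fix k assume "0 \<le> k" "k < N"
  then have "0 \<le> r k" "r k < N" "0 \<le> r' k" "r' k < N" using root_range assms by auto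
  then show "r k = r' k"
    using congruent_less[of "r k" "r' k"] congruent_less[of "r' k" "r k"] assms(5)[of k]
      dvd_diff_commute[of N "r k" "r' k"] by auto
qed

text \<open>Lifts with the same projection descend to roots with the same projection, and these
  coincide. Hence the projection is a complete invariant.\<close>

lemma flip_rel_symmetric_iff:
  assumes p: "symmetric_lift p"
  shows "(p, q) \<in> flip_rel\<^sup>* \<longleftrightarrow> symmetric_lift q \<and> (\<forall>k. N dvd q k - p k)"
proof
  assume "(p, q) \<in> flip_rel\<^sup>*"
  then show "symmetric_lift q \<and> (\<forall>k. N dvd q k - p k)" using flip_rel_symmetric p by blast
next
  assume q: "symmetric_lift q \<and> (\<forall>k. N dvd q k - p k)"
  obtain r where r: "(p, r) \<in> flip_rel\<^sup>*" "symmetric_lift r" "0 \<in> cuts r" using reaches_root[OF p] by blast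
  obtain r' where r': "(q, r') \<in> flip_rel\<^sup>*" "symmetric_lift r'" "0 \<in> cuts r'" using reaches_root q by blast
  have "N dvd r' k - r k" for k
  proof -
    have "N dvd r k - p k" "N dvd r' k - q k" "N dvd q k - p k"
      using flip_rel_symmetric[OF r(1) p] flip_rel_symmetric[OF r'(1)] q by auto
    then have "N dvd ((r' k - q k) + (q k - p k)) - (r k - p k)" by (metis dvd_add dvd_diff)
    then show ?thesis by simp
  qed
  then have "r' = r" using root_unique r r' by blast
  moreover have "(r', q) \<in> flip_rel\<^sup>*" using r'(1) sym_rtrancl[OF flip_rel_sym] by (meson symD)
  ultimately show "(p, q) \<in> flip_rel\<^sup>*" using r(1) by simp
qed

text \<open>Modulo \<open>N\<close> the matching is an involution of one period that exchanges
  openers and closers.\<close>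

lemma card_openers:
  assumes p: "symmetric_lift p"
  shows "card {k \<in> {0..<N}. k < p k} = n div 2"
proof -
  note lmp = symmetric_lift_lm[OF p]
  define f where "f k = p k mod N" for k
  define A B where "A = {k \<in> {0..<N}. k < p k}" and "B = {k \<in> {0..<N}. p k < k}"
  have pf: "p (f k) = k + (f k - p k)" for k
    using symmetric_lift_congruent[OF p, of "f k" "p k"] lm_inv[OF lmp, of k]
    by (simp add: f_def mod_eq_dvd_iff[symmetric])
  have ff: "f (f k) = k" if "0 \<le> k" "k < N" for k
  proof -
    have "f (f k) = (k + (f k - p k)) mod N" by (simp add: f_def[of "f k"] pf)
    also have "\<dots> = k mod N"
      unfolding mod_eq_dvd_iff by (simp add: f_def mod_eq_dvd_iff[symmetric])
    finally show ?thesis using that by simp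
  qed
  have f_range: "0 \<le> f k" "f k < N" for k using N_pos by (auto simp: f_def)
  have "bij_betw f A B"
    by (rule bij_betw_byWitness[where f' = f]) (auto simp: A_def B_def pf ff f_range)
  then have "card A = card B" by (rule bij_betw_same_card)
  moreover have "card {0..<N} = card A + card B"
  proof -
    have "{0..<N} = A \<union> B" using lm_neq[OF lmp] by (force simp: A_def B_def neq_iff)
    moreover have "finite A" "finite B" 
      by (rule finite_subset[of _ "{0..<N}"]; auto simp: A_def B_def)+
    moreover have "A \<inter> B = {}" by (auto simp: A_def B_def)
    ultimately show ?thesis by (simp only: card_Un_disjoint)
  qed
  ultimately show ?thesis by (simp add: A_def)
qed

section \<open>Fibres and bracket words\<close>

text \<open>The symmetric lifts with the same projection to the quotient circle as \<open>r\<close>.\<close>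

definition fibre :: "(int \<Rightarrow> int) \<Rightarrow> (int \<Rightarrow> int) set" where
  "fibre r = {q. symmetric_lift q \<and> (\<forall>k. N dvd q k - r k)}"

text \<open>Only two values in the residue class of \<open>r l\<close> modulo \<open>N\<close> lie
  within \<open>N\<close> of \<open>l\<close>: the arc is either kept or turned.\<close>

lemma fibre_opener:
  assumes r: "symmetric_lift r" and q: "q \<in> fibre r" and l: "l < r l"
  shows "q l = r l \<or> q l = r l - N"
proof -
  have lm: "lifted_matching q" "lifted_matching r" and dvd: "N dvd q l - r l"
    using q r by (auto simp: fibre_def symmetric_lift_def)
  have "q l \<le> r l"
    using congruent_less[OF dvd] lm_less[OF lm(1), of l] l by simp
  moreover have "r l \<le> q l + N"
    using congruent_less[of "r l" "q l + N"] dvd dvd_diff_commute[of N "q l" "r l"]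
      dvd_diff_left_iff[of N N "r l - q l"] lm_less[OF lm(2), of l] lm_greater[OF lm(1), of l]
    by (simp add: algebra_simps)
  moreover have "q l < r l \<Longrightarrow> q l \<le> r l - N"
    using congruent_less[of "q l" "r l - N"] dvd dvd_add_left_iff[of N N "q l - r l"]
    by (simp add: algebra_simps)
  ultimately show ?thesis by force
qed

text \<open>An element of the fibre of a root \<open>r\<close> is determined by the arc of \<open>r\<close> that it turns last: the arcs
  of \<open>r\<close> turned on the way are exactly those enclosing it.\<close>

lemma fibre_outer_arc:
  assumes r: "symmetric_lift r" "0 \<in> cuts r" and q: "q \<in> fibre r" and y: "0 \<le> y" "q y < 0" "q y \<in> cuts q"
  shows "y < N" "y < r y" "q y = r y - N"
    "\<And>k. 0 \<le> k \<Longrightarrow> k < N \<Longrightarrow> k < r k \<Longrightarrow> q k = (if k \<le> y \<and> r y \<le> r k then r k - N else r k)"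
proof -
  have sq: "symmetric_lift q" and dvd: "N dvd q k - r k" for k using q by (auto simp: fibre_def)
  note lm = symmetric_lift_lm[OF sq]
  have qq: "q (q y) = y" using lm_inv[OF lm] .
  have near: "y < q y + N" using lm_less[OF lm, of "q y"] qq by simp
  then show "y < N" using y by simp
  have ry: "0 \<le> r y" "r y < N" using root_range[OF r y(1) \<open>y < N\<close>] by auto
  show eq: "q y = r y - N"
    using congruent_less[of "q y + N" "r y"] congruent_less[of "r y" "q y + N"] dvd[of y] ry y near
      dvd_diff_commute[of N "q y" "r y"] dvd_add_left_iff[of N N "q y - r y"] dvd_diff_left_iff[of N N "r y - q y"]
    by (simp add: algebra_simps)
  show "y < r y" using eq near by simp
  have end_cut: "y + 1 \<in> cuts q" using next_cut[OF lm y(3)] qq by simp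
  fix k assume k: "0 \<le> k" "k < N" "k < r k"
  have rk: "r k < N" using root_range[OF r k(1,2)] by simp
  consider "q k = r k" | "q k = r k - N" using fibre_opener[OF r(1) q k(3)] by blast
  then show "q k = (if k \<le> y \<and> r y \<le> r k then r k - N else r k)"
  proof cases
    case 1
    \<comment> \<open>An arc of \<open>r\<close> enclosing the one at \<open>y\<close> but left in
      place would cross the turned arc from \<open>r y - N\<close> to \<open>y\<close>.\<close>
    have "\<not> (k \<le> y \<and> r y \<le> r k)"
    proof
      assume *: "k \<le> y \<and> r y \<le> r k"
      have "k \<noteq> y" using 1 eq N_pos by auto
      then have "q y < k" "k < q (q y)" "q (q y) < q k"
        using * y k 1 qq \<open>y < r y\<close> by auto
      then show False using lm_non_crossing[OF lm] by blast
    qed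
    then show ?thesis using 1 by auto
  next
    case 2
    \<comment> \<open>A turned arc not enclosing the one at \<open>y\<close> would pass over one of
      the cuts \<open>y + 1\<close> and \<open>q y\<close>.\<close>
    have qqk: "q (r k - N) = k" using lm_inv[OF lm, of k] 2 by simp
    have "k < y + 1" using cutsD[OF end_cut, of "r k - N"] qqk rk y by simp
    moreover have "\<not> r k - N < q y" using cutsD[OF y(3), of "r k - N"] qqk k y by auto
    ultimately show ?thesis using 2 eq by simp
  qed
qed

lemma fibre_eqI:
  assumes r: "symmetric_lift r" "0 \<in> cuts r" and q: "q \<in> fibre r" "q' \<in> fibre r"
    and eq: "\<And>k. 0 \<le> k \<Longrightarrow> k < N \<Longrightarrow> k < r k \<Longrightarrow> q k = q' k"
  shows "q = q'"
proof -
  have sq: "symmetric_lift q" "symmetric_lift q'" using q by (auto simp: fibre_def)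
  note lm = symmetric_lift_lm[OF sq(1)] symmetric_lift_lm[OF sq(2)] symmetric_lift_lm[OF r(1)]
  show ?thesis
  proof (rule symmetric_lift_eqI[OF sq])
    fix k assume k: "0 \<le> k" "k < N"
    show "q k = q' k"
    proof (cases "k < r k")
      case False
      define l where "l = r k"
      have rl: "r l = k" using lm_inv[OF lm(3)] by (simp add: l_def)
      have l: "0 \<le> l" "l < N" "l < r l"
        using root_range[OF r k] rl False lm_neq[OF lm(3), of k] by (auto simp: l_def)
      have same: "q l = q' l" using eq[OF l] .
      consider "q l = k" | "q l = k - N" using fibre_opener[OF r(1) q(1) l(3)] rl by auto
      then show ?thesis
      proof cases
        case 1
        then show ?thesis using lm_inv[OF lm(1), of l] lm_inv[OF lm(2), of l] same by simp
      next
        case 2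
        then have "q (k - N) = l" "q' (k - N) = l" using lm_inv[OF lm(1), of l] lm_inv[OF lm(2), of l] same by simp_all
        then show ?thesis
          using symmetric_lift_congruent[OF sq(1), of k "k - N"] symmetric_lift_congruent[OF sq(2), of k "k - N"] by simp
      qed
    qed (use eq k in blast)
  qed
qed

text \<open>Antipodal flips remove all arcs above \<open>y\<close>, which makes it a cut because it
  opens; turning there makes its arc the last one turned.\<close>

lemma fibre_opener_turned:
  assumes r: "symmetric_lift r" "0 \<in> cuts r" and y: "0 \<le> y" "y < N" "y < r y"
  shows "\<exists>q\<in>fibre r. q y < 0 \<and> q y \<in> cuts q"
proof -
  note lmr = symmetric_lift_lm[OF r(1)]
  obtain q where q: "(r, q) \<in> flip_rel\<^sup>*" "q y = r y"
    and unc: "symmetric_cuts q \<longrightarrow> \<not> (\<exists>a\<in>cuts q. a < y \<and> y < q a)"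
    using uncover[OF lmr, of y] by blast
  have sq: "symmetric_lift q" using flip_rel_symmetric[OF q(1) r(1)] by simp
  note lmq = symmetric_lift_lm[OF sq]
  have "y \<in> cuts q"
  proof (rule ccontr)
    assume "y \<notin> cuts q"
    then obtain a where a: "a \<in> cuts q" "a < y" "y \<le> q a" using covering_cut[OF lmq] by blast
    then have "y = q a" using unc symmetric_lift_cuts[OF sq] by force
    then show False using lm_inv[OF lmq, of a] q(2) y a by simp
  qed
  define s where "s = turn q y"
  have "(r, s) \<in> flip_rel\<^sup>*"
    using q(1) flip_rel_turn[OF sq \<open>y \<in> cuts q\<close>] unfolding s_def by (rule rtrancl_into_rtrancl)
  then have s: "s \<in> fibre r" using flip_rel_symmetric_iff[OF r(1)] by (simp add: fibre_def)
  then have ss: "symmetric_lift s" by (simp add: fibre_def)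
  have "s y = r y - N" by (simp add: s_def turn_def q(2))
  moreover have "r y < N" using root_range[OF r y(1,2)] by simp
  moreover have "r y - N \<in> cuts s"
    using symmetric_lift_cut_congruent[OF ss, of "r y - N" "r y"] turn_turn(1)[OF sq \<open>y \<in> cuts q\<close>] q(2)
    by (simp add: s_def)
  ultimately show ?thesis using s by (intro bexI[of _ s]) auto
qed

text \<open>The elements other than the root correspond to the \<open>n / 2\<close> arcs of the
  quotient matching. In terms of faces, that many disjoint chords divide a disc into one more
  region.\<close>

lemma card_fibre:
  assumes r: "symmetric_lift r" "0 \<in> cuts r"
  shows "card (fibre r) = n div 2 + 1"
proof -
  note lmr = symmetric_lift_lm[OF r(1)]
  \<comment> \<open>\<open>y\<close> ends the maximal arc over the gap before 0. Every element but
    the root has such an arc, and only one, so \<open>SOME\<close> is unambiguous.\<close>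
  define T where "T q y \<longleftrightarrow> 0 \<le> y \<and> q y < 0 \<and> q y \<in> cuts q" for q y
  define t where "t q = (SOME y. T q y)" for q
  have rr: "r \<in> fibre r" using r by (simp add: fibre_def)
  have T_ex: "T q (t q)" if q: "q \<in> fibre r - {r}" for q
  proof -
    have sq: "symmetric_lift q" using q by (simp add: fibre_def)
    have "0 \<notin> cuts q" using root_unique[OF sq r(1) _ r(2)] q by (auto simp: fibre_def)
    then obtain c where c: "c \<in> cuts q" "c < 0" "0 \<le> q c"
      using covering_cut[OF symmetric_lift_lm[OF sq]] by blast
    then have "T q (q c)" using lm_inv[OF symmetric_lift_lm[OF sq]] by (simp add: T_def)
    then show ?thesis unfolding t_def by (rule someI)
  qed
  define P where "P = {k \<in> {0..<N}. k < r k}"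
  have "bij_betw t (fibre r - {r}) P"
    unfolding bij_betw_def
  proof
    show "inj_on t (fibre r - {r})"
    proof (rule inj_onI)
      fix q q' assume q: "q \<in> fibre r - {r}" "q' \<in> fibre r - {r}" "t q = t q'"
      show "q = q'"
      proof (rule fibre_eqI[OF r])
        fix k assume k: "0 \<le> k" "k < N" "k < r k"
        show "q k = q' k"
          using fibre_outer_arc(4)[OF r, of q "t q" k] fibre_outer_arc(4)[OF r, of q' "t q'" k] T_ex[OF q(1)]
            T_ex[OF q(2)] k q unfolding T_def by auto
      qed (use q in auto)
    qed
    show "t ` (fibre r - {r}) = P"
    proof
      show "t ` (fibre r - {r}) \<subseteq> P"
      proof
        fix y assume "y \<in> t ` (fibre r - {r})"
        then obtain q where q: "q \<in> fibre r - {r}" "y = t q" by blast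
        then show "y \<in> P" using fibre_outer_arc(1,2)[OF r, of q y] T_ex[OF q(1)] unfolding T_def P_def by auto
      qed
      show "P \<subseteq> t ` (fibre r - {r})"
      proof
        fix y assume "y \<in> P"
        then have y: "0 \<le> y" "y < N" "y < r y" by (auto simp: P_def)
        obtain q where q: "q \<in> fibre r" "q y < 0" "q y \<in> cuts q" using fibre_opener_turned[OF r y] by blast
        have "q \<noteq> r" using q y by auto
        then have q': "q \<in> fibre r - {r}" using q by simp
        have sq: "symmetric_lift q" using q by (simp add: fibre_def)
        have tq: "0 \<le> t q" "q (t q) < 0" "q (t q) \<in> cuts q" using T_ex[OF q'] by (auto simp: T_def)
        have inv: "q (q y) = y" "q (q (t q)) = t q" using lm_inv[OF symmetric_lift_lm[OF sq]] by auto
        have "\<not> q (t q) < q y" using cutsD[OF q(3), of "q (t q)"] inv(2) tq(1) q(2) by auto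
        moreover have "\<not> q y < q (t q)" using cutsD[OF tq(3), of "q y"] inv(1) tq(2) y(1) by auto
        ultimately have "q y = q (t q)" by simp
        then have "y = t q" using inv by metis
        then show "y \<in> t ` (fibre r - {r})" using q' by blast
      qed
    qed
  qed
  then have "card (fibre r - {r}) = card P" "finite (fibre r - {r}) \<longleftrightarrow> finite P"
    by (rule bij_betw_same_card, rule bij_betw_finite)
  moreover have "finite P" unfolding P_def by (rule finite_subset[of _ "{0..<N}"]) auto
  moreover have "card P = n div 2" unfolding P_def by (rule card_openers[OF r(1)])
  ultimately have "finite (fibre r - {r})" "card (fibre r - {r}) = n div 2" by auto
  then show ?thesis using card.insert[of "fibre r - {r}" r] rr by (simp add: insert_absorb)
qed

section \<open>Symmetric lifts as bracket words\<close>

definition opener_set :: "(int \<Rightarrow> int) \<Rightarrow> int set" where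
  "opener_set p = {k \<in> {0..<N}. k < p k}"

lemma opener_set_iff:
  assumes p: "symmetric_lift p"
  shows "k < p k \<longleftrightarrow> k mod N \<in> opener_set p"
proof -
  have "N dvd k - k mod N" by (simp add: minus_mod_eq_mult_div)
  then have "p k = p (k mod N) + (k - k mod N)" using symmetric_lift_congruent[OF p] by blast
  then show ?thesis using N_pos by (auto simp: opener_set_def)
qed

text \<open>Partners of brackets are determined from the inside out, hence the induction on the
  length of an arc.\<close>

lemma opener_set_inj:
  assumes p: "symmetric_lift p" and q: "symmetric_lift q" and eq: "opener_set p = opener_set q"
  shows "p = q"
proof -
  note lmp = symmetric_lift_lm[OF p] and lmq = symmetric_lift_lm[OF q]
  have same: "k < p k \<longleftrightarrow> k < q k" for k using opener_set_iff[OF p] opener_set_iff[OF q] eq by simp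
  have opener: "k < p k \<Longrightarrow> q k = p k" for k
  proof (induction "nat (p k - k)" arbitrary: k rule: less_induct)
    case less
    have inner: "q y = p y" if y: "k < y" "y < p k" for y
    proof -
      have py: "k < p y" "p y < p k" using lm_nested[OF lmp y] by auto
      show ?thesis
      proof (cases "y < p y")
        case True
        then show ?thesis using less.hyps[of y] y py by simp
      next
        case False
        then have "p y < p (p y)" using lm_inv[OF lmp, of y] lm_neq[OF lmp, of y] by simp
        then have "q (p y) = p (p y)" using less.hyps[of "p y"] y py lm_inv[OF lmp, of y] by simp
        then show ?thesis using lm_inv[OF lmp, of y] lm_inv[OF lmq, of "p y"] by simp
      qed
    qed
    \<comment> \<open>\<open>l\<close> is what \<open>q\<close> matches with the closer
      \<open>p k\<close>. Inside the arc it is already taken by the induction hypothesis; left of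
      \<open>k\<close> it would force \<open>q k\<close> inside, where everything is taken as
      well.\<close>
    define l where "l = q (p k)"
    have ql: "q l = p k" using lm_inv[OF lmq] by (simp add: l_def)
    have "l < p k"
      using same[of "p k"] lm_inv[OF lmp, of k] lm_neq[OF lmq, of "p k"] less.prems unfolding l_def by simp
    consider "l = k" | "k < l" | "l < k" by linarith
    then show ?case
    proof cases
      case 1
      then show ?thesis using ql by simp
    next
      case 2
      then have "p l = p k" using inner[of l] \<open>l < p k\<close> ql by simp
      then show ?thesis using lm_inj[OF lmp] 2 by simp
    next
      case 3
      then have "q k < p k" using lm_nested[OF lmq, of l k] ql less.prems by simp
      moreover have "k < q k" using same[of k] less.prems by simp
      ultimately have "p (q k) = k" using inner[of "q k"] lm_inv[OF lmq, of k] by simp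
      then show ?thesis using lm_inv[OF lmp, of "q k"] by simp
    qed
  qed
  show ?thesis
  proof
    fix k
    show "p k = q k"
    proof (cases "k < p k")
      case False
      then have "q (p k) = k" using opener[of "p k"] lm_inv[OF lmp, of k] lm_neq[OF lmp, of k] by simp
      then show ?thesis using lm_inv[OF lmq, of "p k"] by simp
    qed (use opener in simp)
  qed
qed

end

text \<open>\<open>S\<close> is the set of opening brackets in one period of a balanced word; \<open>h\<close> is the height function.\<close>

locale bracket_word = even_circle +
  fixes S :: "int set"
  assumes S_sub: "S \<subseteq> {0..<N}" and S_card: "card S = n div 2"
begin

definition s :: "int \<Rightarrow> int" where
  "s k = (if k mod N \<in> S then 1 else - 1)"

text \<open>The height just before position \<open>k\<close>. The sum stops at the residue, so
  periodicity is immediate, and balance of the word is needed in \<open>h_step\<close> at the period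
  boundary.\<close>

definition h :: "int \<Rightarrow> int" where
  "h k = (\<Sum>i\<in>{0..<k mod N}. s i)"

text \<open>The matching bracket is the step with which the height first returns; heights are taken
  before a position, so the return shows at \<open>l + 1\<close>.\<close>

definition arc :: "int \<Rightarrow> int \<Rightarrow> bool" where
  "arc k l \<longleftrightarrow> k < l \<and> h (l + 1) = h k \<and> (\<forall>x. k < x \<and> x \<le> l \<longrightarrow> h k < h x)"

lemma s_cases: "s k = 1 \<or> s k = - 1"
  by (simp add: s_def)

lemma h_period: "h (k + N) = h k"
  by (simp add: h_def)

lemma s_sum: "(\<Sum>i\<in>{0..<N}. s i) = 0"
proof -
  have "(\<Sum>i\<in>{0..<N}. s i) = (\<Sum>i\<in>{0..<N}. if i \<in> S then 1 else - 1)"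
    by (rule sum.cong) (auto simp: s_def)
  also have "\<dots> = (\<Sum>i\<in>S. 1) + (\<Sum>i\<in>{0..<N} - S. - 1)"
    using S_sub by (subst sum.If_cases) (auto simp: Int_absorb1 Diff_eq)
  also have "\<dots> = int (card S) - int (card ({0..<N} - S))" by simp
  also have "card ({0..<N} - S) = n - card S"
    using card_Diff_subset[OF finite_subset[OF S_sub] S_sub] by simp
  finally show ?thesis using S_card even_n by (auto elim!: evenE)
qed

lemma h_step: "h (k + 1) = h k + s k"
proof (cases "k mod N + 1 < N")
  case True
  then have "(k + 1) mod N = k mod N + 1"
    using mod_add_left_eq[of k N 1] N_pos by (metis mod_pos_pos_trivial add_nonneg_nonneg pos_mod_sign zero_le_one)
  moreover have "{0..<k mod N + 1} = insert (k mod N) {0..<k mod N}" using N_pos by auto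
  ultimately show ?thesis by (simp add: h_def s_def)
next
  case False
  then have k: "k mod N = N - 1" using pos_mod_bound[OF N_pos, of k] by simp
  then have "(k + 1) mod N = 0" using mod_add_left_eq[of k N 1] by simp
  then have "h (k + 1) = 0" by (simp add: h_def)
  moreover have "{0..<N} = insert (k mod N) {0..<k mod N}" using N_pos k by auto
  then have "h k + s k = 0" using s_sum by (simp add: h_def s_def)
  ultimately show ?thesis by simp
qed

lemma h_parity: "k \<le> l \<Longrightarrow> even (h l - h k - (l - k))"
proof (induction l rule: int_ge_induct)
  case (step i)
  have "h (i + 1) - h k - (i + 1 - k) = (h i - h k - (i - k)) + (s i - 1)" by (simp add: h_step)
  moreover have "even (s i - 1)" using s_cases[of i] by auto
  ultimately show ?case using step by (metis dvd_add)
qed simp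

lemma arc_odd: "arc k l \<Longrightarrow> odd (l - k)"
  using h_parity[of k "l + 1"] by (auto simp: arc_def)

lemma arc_above: "arc k l \<Longrightarrow> k < x \<Longrightarrow> x \<le> l \<Longrightarrow> h k < h x"
  by (simp add: arc_def)

lemma arc_unique_right: "arc k l \<Longrightarrow> arc k l' \<Longrightarrow> l = l'"
proof (rule ccontr)
  assume a: "arc k l" "arc k l'" "l \<noteq> l'"
  have "l + 1 \<le> l' \<or> l' + 1 \<le> l" using a(3) by linarith
  then show False
    using a arc_above[OF a(2), of "l + 1"] arc_above[OF a(1), of "l' + 1"] by (auto simp: arc_def)
qed

lemma arc_unique_left: "arc k l \<Longrightarrow> arc k' l \<Longrightarrow> k = k'"
proof (rule ccontr)
  assume a: "arc k l" "arc k' l" "k \<noteq> k'"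
  then consider "k < k'" | "k' < k" by linarith
  then show False using a unfolding arc_def by cases force+
qed

lemma arc_ends: "arc k l \<Longrightarrow> s k = 1" "arc k l \<Longrightarrow> s l = - 1"
proof -
  assume a: "arc k l"
  have "h k < h (k + 1)" "h (l + 1) < h l" using a by (auto simp: arc_def)
  then show "s k = 1" "s l = - 1" using h_step[of k] h_step[of l] s_cases[of k] s_cases[of l] by auto
qed

lemma arc_period: "arc (k + N) (l + N) \<longleftrightarrow> arc k l"
proof -
  have "(\<forall>x. k + N < x \<and> x \<le> l + N \<longrightarrow> h k < h x) \<longleftrightarrow> (\<forall>x. k < x \<and> x \<le> l \<longrightarrow> h k < h x)"
  proof
    assume a: "\<forall>x. k + N < x \<and> x \<le> l + N \<longrightarrow> h k < h x"
    show "\<forall>x. k < x \<and> x \<le> l \<longrightarrow> h k < h x" using a[rule_format, of "_ + N"] by (simp add: h_period)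
  next
    assume a: "\<forall>x. k < x \<and> x \<le> l \<longrightarrow> h k < h x"
    have per: "h (x - N) = h x" for x using h_period[of "x - N"] by simp
    show "\<forall>x. k + N < x \<and> x \<le> l + N \<longrightarrow> h k < h x" using a[rule_format, of "_ - N"] by (simp add: per)
  qed
  moreover have "h (l + N + 1) = h (l + 1)" using h_period[of "l + 1"] by (simp add: algebra_simps)
  ultimately show ?thesis by (simp add: arc_def h_period)
qed

lemma arc_from_opener:
  assumes "s k = 1"
  shows "\<exists>l. arc k l \<and> l < k + N"
proof -
  define A where "A = {l \<in> {k<..k + N - 1}. h (l + 1) = h k}"
  have fin: "finite A" unfolding A_def by (rule finite_subset[of _ "{k<..k + N - 1}"]) auto
  \<comment> \<open>The height repeats after one period, so a return occurs there at the latest;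
    this also keeps the arc shorter than \<open>N\<close>.\<close>
  have "k + N - 1 \<in> A" using N_ge_2 h_period[of k] by (simp add: A_def)
  then have m: "Min A \<in> A" using fin by (intro Min_in) auto
  have "h k < h x" if "k + 1 \<le> x" "x \<le> Min A" for x
    using that
  proof (induction x rule: int_ge_induct)
    case base
    then show ?case using h_step[of k] assms by simp
  next
    case (step x)
    have "x \<notin> A" using Min_le[OF fin, of x] step by auto
    \<comment> \<open>Heights change by one, so they cannot drop below \<open>h k\<close> without
      meeting it.\<close>
    then have "h (x + 1) \<noteq> h k" using step m by (auto simp: A_def)
    then show ?case using h_step[of x] s_cases[of x] step by auto
  qed
  then have "arc k (Min A)" using m by (auto simp: arc_def A_def)
  then show ?thesis using m by (auto simp: A_def)
qed

lemma arc_to_closer: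
  assumes "s l = - 1"
  shows "\<exists>k. arc k l \<and> l - N < k"
proof -
  define A where "A = {k \<in> {l - N + 1..<l}. h k = h (l + 1)}"
  have fin: "finite A" unfolding A_def by (rule finite_subset[of _ "{l - N + 1..<l}"]) auto
  have "l - N + 1 \<in> A" using N_ge_2 h_period[of "l - N + 1"] by (simp add: A_def)
  then have m: "Max A \<in> A" using fin by (intro Max_in) auto
  have "h (l + 1) < h x" if "x \<le> l" "Max A < x" for x
    using that
  proof (induction x rule: int_le_induct)
    case base
    then show ?case using h_step[of l] assms by simp
  next
    case (step x)
    have "x - 1 \<notin> A" using Max_ge[OF fin, of "x - 1"] step by auto
    then have "h (x - 1) \<noteq> h (l + 1)" using step m by (auto simp: A_def)
    then show ?case using h_step[of "x - 1"] s_cases[of "x - 1"] step by auto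
  qed
  then have "arc (Max A) l" using m by (auto simp: arc_def A_def)
  then show ?thesis using m by (auto simp: A_def)
qed

definition partner :: "int \<Rightarrow> int" where
  "partner k = (if s k = 1 then THE l. arc k l else THE l. arc l k)"

lemma partner_opener:
  assumes "s k = 1"
  shows "arc k (partner k)" "partner k < k + N"
proof -
  obtain l where l: "arc k l" "l < k + N" using arc_from_opener[OF assms] by blast
  then have "partner k = l" unfolding partner_def using assms arc_unique_right by (simp add: the_equality)
  then show "arc k (partner k)" "partner k < k + N" using l by auto
qed

lemma partner_closer:
  assumes "s k = - 1"
  shows "arc (partner k) k" "k - N < partner k"
proof -
  obtain l where l: "arc l k" "k - N < l" using arc_to_closer[OF assms] by blast
  then have "partner k = l" unfolding partner_def using assms arc_unique_left by (simp add: the_equality)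
  then show "arc (partner k) k" "k - N < partner k" using l by auto
qed

lemma partner_eq:
  assumes "arc k l"
  shows "partner k = l" "partner l = k"
  using partner_opener(1)[OF arc_ends(1)[OF assms]] partner_closer(1)[OF arc_ends(2)[OF assms]]
    arc_unique_left arc_unique_right assms by blast+

lemma less_partner_iff: "k < partner k \<longleftrightarrow> s k = 1"
  using partner_opener(1)[of k] partner_closer(1)[of k] s_cases[of k] by (auto simp: arc_def)

lemma symmetric_lift_partner: "symmetric_lift partner"
  unfolding symmetric_lift_def
proof
  have arcs: "arc k (partner k) \<or> arc (partner k) k" for k
    using partner_opener partner_closer s_cases by blast
  show per: "\<forall>k. partner (k + N) = partner k + N"
    using arcs arc_period partner_eq by metis
  show "lifted_matching partner"
    unfolding lifted_matching_def
  proof (intro conjI allI)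
    fix k l
    show "partner (partner k) = k" using arcs[of k] partner_eq by metis
    show "odd (partner k - k)" using arcs[of k] arc_odd by (auto dest!: arc_odd)
    show "\<bar>partner k - k\<bar> < N"
      using s_cases[of k] partner_opener[of k] partner_closer[of k] by (auto simp: arc_def)
    have "partner (k + N + N) = partner k + N + N" by (simp only: per[rule_format])
    then show "partner (k + 2 * N) = partner k + 2 * N" by (simp only: mult_2 add.assoc)
    show "\<not> (k < l \<and> l < partner k \<and> partner k < partner l)"
    proof
      assume kl: "k < l \<and> l < partner k \<and> partner k < partner l"
      then have "s k = 1" "s l = 1" using less_partner_iff[of k] less_partner_iff[of l] by auto
      then have arcs: "arc k (partner k)" "arc l (partner l)" using partner_opener by auto
      \<comment> \<open>Of two crossing arcs the second stays above the height at \<open>l\<close>,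
        hence above that at \<open>k\<close>, just where the first has returned to it.\<close>
      have "h k < h l" "h l < h (partner k + 1)"
        using arc_above[OF arcs(1), of l] arc_above[OF arcs(2), of "partner k + 1"] kl by auto
      then show False using arcs(1) by (simp add: arc_def)
    qed
  qed
qed

lemma opener_set_partner: "opener_set partner = S"
  using S_sub by (auto simp: opener_set_def less_partner_iff s_def split: if_splits)

end

context even_circle
begin

lemma card_symmetric_lifts: "card {p. symmetric_lift p} = n choose (n div 2)"
proof -
  have "bij_betw opener_set {p. symmetric_lift p} {S. S \<subseteq> {0..<N} \<and> card S = n div 2}"
    unfolding bij_betw_def
  proof
    show "inj_on opener_set {p. symmetric_lift p}"
      using opener_set_inj by (auto intro: inj_onI)
    show "opener_set ` {p. symmetric_lift p} = {S. S \<subseteq> {0..<N} \<and> card S = n div 2}"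
    proof
      show "opener_set ` {p. symmetric_lift p} \<subseteq> {S. S \<subseteq> {0..<N} \<and> card S = n div 2}"
        using card_openers by (auto simp: opener_set_def)
      show "{S. S \<subseteq> {0..<N} \<and> card S = n div 2} \<subseteq> opener_set ` {p. symmetric_lift p}"
      proof
        fix S assume "S \<in> {S. S \<subseteq> {0..<N} \<and> card S = n div 2}"
        then interpret bracket_word n S by unfold_locales auto
        show "S \<in> opener_set ` {p. symmetric_lift p}"
          using opener_set_partner symmetric_lift_partner by blast
      qed
    qed
  qed
  then have "card {p. symmetric_lift p} = card {S. S \<subseteq> {0..<N} \<and> card S = n div 2}"
    by (rule bij_betw_same_card)
  then show ?thesis by (simp add: n_subsets)
qed

end

section \<open>Graphs\<close>

definition graph_adj :: "'v set \<Rightarrow> 'v set set \<Rightarrow> ('v \<times> 'v) set" where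
  "graph_adj V E = {(x, y). x \<in> V \<and> y \<in> V \<and> {x, y} \<in> E}"

lemma graph_component_alt: "graph_component V E v = {u \<in> V. (v, u) \<in> (graph_adj V E)\<^sup>*}"
  by (simp add: graph_component_def graph_adj_def)

lemma sym_graph_adj: "sym (graph_adj V E)"
  by (auto simp: sym_def graph_adj_def insert_commute)

lemma graph_component_self: "v \<in> V \<Longrightarrow> v \<in> graph_component V E v"
  by (simp add: graph_component_alt)

lemma graph_component_eqI:
  assumes "u \<in> graph_component V E v"
  shows "graph_component V E u = graph_component V E v"
proof -
  have vu: "(v, u) \<in> (graph_adj V E)\<^sup>*" using assms by (simp add: graph_component_alt)
  then have uv: "(u, v) \<in> (graph_adj V E)\<^sup>*" using sym_rtrancl[OF sym_graph_adj] by (meson symD)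
  show ?thesis
    unfolding graph_component_alt using vu uv by (auto intro: rtrancl_trans)
qed

text \<open>A path that starts in the component never leaves it, so all its edges survive the
  restriction.\<close>

lemma graph_connected_component:
  assumes "v \<in> V"
  shows "graph_connected (graph_component V E v) (induced_edges E (graph_component V E v))"
proof -
  define K where "K = graph_component V E v"
  have path: "(u, w) \<in> (graph_adj K (induced_edges E K))\<^sup>* \<and> w \<in> K"
    if "u \<in> K" "(u, w) \<in> (graph_adj V E)\<^sup>*" for u w
    using that(2,1)
  proof (induction rule: rtrancl_induct)
    case (step w w')
    then have w: "w \<in> K" "(u, w) \<in> (graph_adj K (induced_edges E K))\<^sup>*" by auto
    have "w' \<in> K"
      using w(1) step(2) unfolding K_def graph_component_alt
      by (auto simp: graph_adj_def intro: rtrancl_into_rtrancl)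
    then have "(w, w') \<in> graph_adj K (induced_edges E K)"
      using w(1) step(2) by (auto simp: graph_adj_def induced_edges_def)
    then show ?case using w \<open>w' \<in> K\<close> by (meson rtrancl_into_rtrancl)
  qed simp
  have "graph_component K (induced_edges E K) u = K" if u: "u \<in> K" for u
  proof
    show "graph_component K (induced_edges E K) u \<subseteq> K" by (auto simp: graph_component_def)
    show "K \<subseteq> graph_component K (induced_edges E K) u"
    proof
      fix w assume "w \<in> K"
      then have "w \<in> graph_component V E u" using graph_component_eqI u unfolding K_def by metis
      then have "(u, w) \<in> (graph_adj V E)\<^sup>*" by (simp add: graph_component_alt)
      then show "w \<in> graph_component K (induced_edges E K) u"
        using path[OF u] by (simp add: graph_component_alt)
    qed
  qed
  moreover have "K \<noteq> {}" using graph_component_self[OF assms] unfolding K_def by blast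
  ultimately show ?thesis unfolding graph_connected_def K_def by blast
qed

text \<open>In a maximal path inside \<open>A\<close>, both neighbours of the first vertex lie on the path.\<close>

lemma min_degree_two_imp_cycle:
  assumes fin: "finite A" and "A \<noteq> {}" "A \<subseteq> V"
    and deg: "\<And>v. v \<in> A \<Longrightarrow> \<exists>u\<in>A. \<exists>w\<in>A. u \<noteq> w \<and> u \<noteq> v \<and> w \<noteq> v \<and> {v, u} \<in> E \<and> {v, w} \<in> E"
  shows "\<exists>p. graph_cycle V E p"
proof -
  define path where "path p \<longleftrightarrow> p \<noteq> [] \<and> distinct p \<and> set p \<subseteq> A \<and> (\<forall>i. Suc i < length p \<longrightarrow> {p ! i, p ! Suc i} \<in> E)" for p
  have len: "length p \<le> card A" if "path p" for p
    using that card_mono[OF fin, of "set p"] distinct_card[of p] by (auto simp: path_def)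
  obtain v0 where "v0 \<in> A" using \<open>A \<noteq> {}\<close> by blast
  then have "path [v0]" by (simp add: path_def)
  moreover have "\<forall>p. path p \<longrightarrow> length p < Suc (card A)" using len by (simp add: less_Suc_eq_le)
  ultimately obtain p where p: "path p" and max: "\<And>p'. path p' \<Longrightarrow> length p' \<le> length p"
    using ex_has_greatest_nat[of path "[v0]" length "Suc (card A)"] by blast
  have hd: "hd p \<in> A" "p \<noteq> []" using p by (auto simp: path_def)
  have on_path: "u \<in> set p" if "u \<in> A" "{hd p, u} \<in> E" for u
  proof (rule ccontr)
    assume "u \<notin> set p"
    have "{(u # p) ! i, (u # p) ! Suc i} \<in> E" if "Suc i < length (u # p)" for i
    proof (cases i)
      case 0
      then show ?thesis using \<open>{hd p, u} \<in> E\<close> hd(2) by (simp add: hd_conv_nth insert_commute)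
    next
      case (Suc j)
      then show ?thesis using p \<open>Suc i < length (u # p)\<close> by (simp add: path_def)
    qed
    then have "path (u # p)" using p \<open>u \<notin> set p\<close> \<open>u \<in> A\<close> unfolding path_def by simp
    then show False using max[of "u # p"] by simp
  qed
  obtain u w where uw: "u \<in> A" "w \<in> A" "u \<noteq> w" "u \<noteq> hd p" "w \<noteq> hd p" "{hd p, u} \<in> E" "{hd p, w} \<in> E"
    using deg[OF hd(1)] by blast
  obtain i where i: "i < length p" "p ! i = u" using on_path[OF uw(1,6)] by (auto simp: in_set_conv_nth)
  obtain j where j: "j < length p" "p ! j = w" using on_path[OF uw(2,7)] by (auto simp: in_set_conv_nth)
  have "i \<noteq> 0" "j \<noteq> 0" using i(2) j(2) uw(4,5) hd_conv_nth[OF hd(2)] by metis+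
  moreover have "i \<noteq> j" using i(2) j(2) uw(3) by auto
  \<comment> \<open>Of two distinct nonzero positions the larger is at least 2, so the edge back to
    the head closes a cycle with at least three vertices.\<close>
  ultimately have "2 \<le> max i j" "max i j < length p" "{hd p, p ! max i j} \<in> E"
    using i j uw(6,7) by (auto simp: max_def)
  then obtain m where m: "2 \<le> m" "m < length p" "{hd p, p ! m} \<in> E" by blast
  define c where "c = take (Suc m) p"
  have "graph_cycle V E c"
    unfolding graph_cycle_def
  proof (intro conjI allI impI)
    show "3 \<le> length c" using m by (simp add: c_def)
    show "distinct c" using p by (simp add: c_def path_def)
    show "set c \<subseteq> V" using p \<open>A \<subseteq> V\<close> set_take_subset[of "Suc m" p] by (auto simp: c_def path_def)
    show "{c ! i, c ! Suc i} \<in> E" if "Suc i < length c" for i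
      using p that by (simp add: c_def path_def)
    have "last c = p ! m" using m by (simp add: c_def take_Suc_conv_app_nth)
    moreover have "hd c = hd p" by (simp add: c_def)
    ultimately show "{last c, hd c} \<in> E" using m by (simp add: insert_commute)
  qed
  then show ?thesis by blast
qed

text \<open>On a cycle, a vertex of maximal rank would have two lower neighbours.\<close>

lemma unique_lower_neighbour_imp_acyclic:
  fixes rk :: "'v \<Rightarrow> nat"
  assumes neq: "\<And>x y. x \<in> V \<Longrightarrow> y \<in> V \<Longrightarrow> {x, y} \<in> E \<Longrightarrow> rk x \<noteq> rk y"
    and unique: "\<And>x y y'. x \<in> V \<Longrightarrow> y \<in> V \<Longrightarrow> y' \<in> V \<Longrightarrow> {x, y} \<in> E \<Longrightarrow> {x, y'} \<in> E \<Longrightarrow>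
      rk y < rk x \<Longrightarrow> rk y' < rk x \<Longrightarrow> y = y'"
  shows "\<nexists>p. graph_cycle V E p"
proof
  assume "\<exists>p. graph_cycle V E p"
  then obtain p where p: "3 \<le> length p" "distinct p" "set p \<subseteq> V" "{last p, hd p} \<in> E"
    "\<And>i. Suc i < length p \<Longrightarrow> {p ! i, p ! Suc i} \<in> E"
    unfolding graph_cycle_def by blast
  define L where "L = length p"
  have edge: "{p ! i, p ! (Suc i mod L)} \<in> E" if "i < L" for i
  proof (cases "Suc i < L")
    case True
    then show ?thesis using p(5)[of i] by (simp add: L_def)
  next
    case False
    then have "i = L - 1" using that by simp
    moreover have "p \<noteq> []" using p(1) by auto
    ultimately show ?thesis using p(4) that by (simp add: L_def last_conv_nth hd_conv_nth)
  qed
  obtain m where m: "m < L" "\<And>i. i < L \<Longrightarrow> rk (p ! i) \<le> rk (p ! m)"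
  proof -
    define R where "R = (\<lambda>i. rk (p ! i)) ` {..<L}"
    have "0 < L" using p(1) by (auto simp: L_def)
    then have "finite R" "R \<noteq> {}" by (auto simp: R_def)
    then have max: "Max R \<in> R" "\<And>x. x \<in> R \<Longrightarrow> x \<le> Max R" by auto
    then obtain m where m: "m < L" "Max R = rk (p ! m)" by (auto simp: R_def)
    show ?thesis
    proof (rule that[OF m(1)])
      show "rk (p ! i) \<le> rk (p ! m)" if "i < L" for i
      proof -
        have "rk (p ! i) \<in> R" using that by (auto simp: R_def)
        then show ?thesis using max(2) m(2) by metis
      qed
    qed
  qed
  \<comment> \<open>The cyclic neighbours of a vertex of maximal rank; they differ because the cycle
    has at least three vertices.\<close>
  define i j where "i = Suc m mod L" and "j = (if m = 0 then L - 1 else m - 1)"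
  have "0 < L" using m(1) by simp
  then have ij: "i < L" "j < L" using m(1) by (auto simp: i_def j_def)
  have "Suc j mod L = m" using m(1) by (auto simp: j_def)
  then have e: "{p ! m, p ! i} \<in> E" "{p ! m, p ! j} \<in> E"
    using edge[OF m(1)] edge[OF ij(2)] by (auto simp: i_def insert_commute)
  have V: "p ! k \<in> V" if "k < L" for k using that p(3) by (auto simp: L_def)
  have "rk (p ! i) < rk (p ! m)" "rk (p ! j) < rk (p ! m)"
    using m(2)[OF ij(1)] m(2)[OF ij(2)] neq[OF V[OF m(1)] V[OF ij(1)] e(1)] neq[OF V[OF m(1)] V[OF ij(2)] e(2)] by auto
  then have "p ! i = p ! j" using unique[OF V[OF m(1)] V[OF ij(1)] V[OF ij(2)] e] by blast
  then have "i = j" using p(2) ij by (simp add: nth_eq_iff_index_eq L_def)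
  moreover have "i \<noteq> j"
  proof (cases "Suc m = L")
    case True
    then show ?thesis using p(1) by (auto simp: i_def j_def L_def)
  next
    case False
    then have "i = Suc m" using m(1) by (simp add: i_def)
    then show ?thesis using p(1) False by (auto simp: j_def L_def)
  qed
  ultimately show False by simp
qed

section \<open>Components of the centered flip graph\<close>

context even_circle
begin

lemma H_edge_iff_flip_rel:
  assumes "lifted_matching p" "lifted_matching q"
  shows "{chords p, chords q} \<in> H_edges n \<longleftrightarrow> (p, q) \<in> flip_rel"
proof -
  have "(\<exists>a c. flips_at q p a c) \<longrightarrow> (\<exists>a c. flips_at p q a c)"
    using flips_at_sym[OF assms(2,1)] by blast
  then have "{chords p, chords q} \<in> H_edges n \<longleftrightarrow> (\<exists>a c. flips_at p q a c)"
    unfolding H_edge_iff[OF assms] by blast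
  then show ?thesis using assms by (simp add: flip_rel_def)
qed

lemma component_chords:
  assumes p: "lifted_matching p"
  shows "graph_component (H_verts n) (H_edges n) (chords p) = chords ` {q. (p, q) \<in> flip_rel\<^sup>*}"
proof
  show "graph_component (H_verts n) (H_edges n) (chords p) \<subseteq> chords ` {q. (p, q) \<in> flip_rel\<^sup>*}"
  proof
    fix M assume "M \<in> graph_component (H_verts n) (H_edges n) (chords p)"
    then have "(chords p, M) \<in> (graph_adj (H_verts n) (H_edges n))\<^sup>*" by (simp add: graph_component_alt)
    then show "M \<in> chords ` {q. (p, q) \<in> flip_rel\<^sup>*}"
    proof (induction rule: rtrancl_induct)
      case (step M M')
      then obtain q where q: "M = chords q" "(p, q) \<in> flip_rel\<^sup>*" by blast
      have MM': "M' \<in> matchings n" "{M, M'} \<in> H_edges n" using step(2) by (auto simp: graph_adj_def H_verts_def)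
      obtain q' where q': "lifted_matching q'" "chords q' = M'" using ex_lifted_matching[OF MM'(1)] .
      have "(q, q') \<in> flip_rel"
        using H_edge_iff_flip_rel[OF flip_rel_lm[OF q(2) p] q'(1)] MM' q q' by simp
      then have "(p, q') \<in> flip_rel\<^sup>*" using q(2) by (rule rtrancl_into_rtrancl[rotated])
      then show ?case using q' by blast
    qed auto
  qed
  show "chords ` {q. (p, q) \<in> flip_rel\<^sup>*} \<subseteq> graph_component (H_verts n) (H_edges n) (chords p)"
  proof
    fix M assume "M \<in> chords ` {q. (p, q) \<in> flip_rel\<^sup>*}"
    then obtain q where q: "M = chords q" "(p, q) \<in> flip_rel\<^sup>*" by blast
    have "(chords p, chords q) \<in> (graph_adj (H_verts n) (H_edges n))\<^sup>*"
      using q(2)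
    proof (induction rule: rtrancl_induct)
      case (step q q')
      then have lm: "lifted_matching q" "lifted_matching q'" by (auto simp: flip_rel_def)
      then have "(chords q, chords q') \<in> graph_adj (H_verts n) (H_edges n)"
        using H_edge_iff_flip_rel[OF lm] step(2) chords_in_matchings by (simp add: graph_adj_def H_verts_def)
      with step.IH show ?case by (rule rtrancl_into_rtrancl)
    qed simp
    then show "M \<in> graph_component (H_verts n) (H_edges n) (chords p)"
      using q chords_in_matchings[OF flip_rel_lm[OF q(2) p]] by (simp add: graph_component_alt H_verts_def)
  qed
qed

lemma centrally_symmetric_iff_lift:
  "lifted_matching p \<Longrightarrow> centrally_symmetric (chords p) \<longleftrightarrow> symmetric_lift p"
  by (simp add: centrally_symmetric_chords_iff symmetric_lift_def)

lemma chords_inj_on: "inj_on chords {p. lifted_matching p}"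
  using chords_inj by (auto intro: inj_onI)

lemma symmetric_matchings_eq: "{M \<in> matchings n. centrally_symmetric M} = chords ` {p. symmetric_lift p}"
proof
  show "{M \<in> matchings n. centrally_symmetric M} \<subseteq> chords ` {p. symmetric_lift p}"
  proof
    fix M assume M: "M \<in> {M \<in> matchings n. centrally_symmetric M}"
    then have "M \<in> matchings n" by simp
    then obtain p where "lifted_matching p" "chords p = M" using ex_lifted_matching by blast
    then show "M \<in> chords ` {p. symmetric_lift p}" using M centrally_symmetric_iff_lift by auto
  qed
  show "chords ` {p. symmetric_lift p} \<subseteq> {M \<in> matchings n. centrally_symmetric M}"
    using chords_in_matchings centrally_symmetric_iff_lift symmetric_lift_lm by auto
qed

lemma card_symmetric_matchings: "card {M \<in> matchings n. centrally_symmetric M} = n choose (n div 2)"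
proof -
  have "inj_on chords {p. symmetric_lift p}"
    using chords_inj_on by (rule inj_on_subset) (auto simp: symmetric_lift_lm)
  then show ?thesis unfolding symmetric_matchings_eq by (simp add: card_image card_symmetric_lifts)
qed

lemma symmetric_component:
  assumes K: "K \<in> H_components n" and M: "M \<in> K" "centrally_symmetric M"
  obtains r where "symmetric_lift r" "0 \<in> cuts r" "K = chords ` fibre r"
    "K = graph_component (H_verts n) (H_edges n) (chords r)" "chords r \<in> H_verts n"
proof -
  obtain v where v: "v \<in> H_verts n" "K = graph_component (H_verts n) (H_edges n) v"
    using K by (auto simp: H_components_def graph_components_def)
  have Mn: "M \<in> matchings n" using M v by (auto simp: graph_component_def H_verts_def)
  obtain p where p: "lifted_matching p" "chords p = M" using ex_lifted_matching[OF Mn] .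
  have sp: "symmetric_lift p" using centrally_symmetric_iff_lift[OF p(1)] p(2) M(2) by simp
  obtain r where r: "(p, r) \<in> flip_rel\<^sup>*" "symmetric_lift r" "0 \<in> cuts r" using reaches_root[OF sp] by blast
  have KM: "K = graph_component (H_verts n) (H_edges n) M"
    using graph_component_eqI M(1) v(2) by metis
  then have "chords r \<in> K" using component_chords[OF p(1)] p(2) r(1) by auto
  then have Kr: "K = graph_component (H_verts n) (H_edges n) (chords r)"
    using graph_component_eqI KM by metis
  moreover have "K = chords ` fibre r"
    unfolding Kr component_chords[OF symmetric_lift_lm[OF r(2)]] fibre_def flip_rel_symmetric_iff[OF r(2)] ..
  moreover have "chords r \<in> H_verts n"
    using chords_in_matchings symmetric_lift_lm r(2) by (simp add: H_verts_def)
  ultimately show ?thesis using that r by blast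
qed

lemma symmetric_component_properties:
  assumes K: "K \<in> H_components n" and M: "M \<in> K" "centrally_symmetric M"
  shows "\<forall>M\<in>K. centrally_symmetric M" "graph_tree K (induced_edges (H_edges n) K)" "card K = n div 2 + 1"
proof -
  obtain r where r: "symmetric_lift r" "0 \<in> cuts r" and Kf: "K = chords ` fibre r"
    and Kr: "K = graph_component (H_verts n) (H_edges n) (chords r)" "chords r \<in> H_verts n"
    using symmetric_component[OF assms] by blast
  have fib: "symmetric_lift q" "lifted_matching q" if "q \<in> fibre r" for q
    using that symmetric_lift_lm by (auto simp: fibre_def)
  have inj: "inj_on chords (fibre r)"
    using chords_inj_on by (rule inj_on_subset) (use fib in auto)
  show "\<forall>M\<in>K. centrally_symmetric M"
    using fib centrally_symmetric_iff_lift unfolding Kf by blast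
  show "card K = n div 2 + 1" unfolding Kf using card_image[OF inj] card_fibre[OF r] by simp
  define rk where "rk M = rank (the_inv_into (fibre r) chords M)" for M
  have rk: "rk (chords q) = rank q" if "q \<in> fibre r" for q
    using the_inv_into_f_f[OF inj that] by (simp add: rk_def)
  have edge: "\<exists>a\<in>cuts q. q' = turn q a"
    if q: "q \<in> fibre r" "q' \<in> fibre r" and "{chords q, chords q'} \<in> induced_edges (H_edges n) K" for q q'
  proof -
    have "(q, q') \<in> flip_rel"
      using H_edge_iff_flip_rel[OF fib(2)[OF q(1)] fib(2)[OF q(2)]] that(3) by (simp add: induced_edges_def)
    then obtain a c where "flips_at q q' a c" by (auto simp: flip_rel_def)
    then show ?thesis using symmetric_flip(1,3)[OF fib(1)[OF q(1)] fib(2)[OF q(2)]] by blast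
  qed
  have "\<nexists>p. graph_cycle K (induced_edges (H_edges n) K) p"
  proof (rule unique_lower_neighbour_imp_acyclic[of _ _ rk])
    fix x y assume x: "x \<in> K" and y: "y \<in> K" and e: "{x, y} \<in> induced_edges (H_edges n) K"
    obtain q q' where q: "q \<in> fibre r" "q' \<in> fibre r" "x = chords q" "y = chords q'" using x y Kf by blast
    obtain a where a: "a \<in> cuts q" "q' = turn q a" using edge[OF q(1,2)] e q by blast
    have "rank (turn q a) \<noteq> rank q"
      by (rule rank_turn_cases[OF fib(1)[OF q(1)] a(1)]) auto
    then show "rk x \<noteq> rk y" using rk q a by simp
  next
    fix x y y' assume xy: "x \<in> K" "y \<in> K" "y' \<in> K" and e: "{x, y} \<in> induced_edges (H_edges n) K"
      "{x, y'} \<in> induced_edges (H_edges n) K" and less: "rk y < rk x" "rk y' < rk x"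
    obtain q q1 q2 where q: "q \<in> fibre r" "q1 \<in> fibre r" "q2 \<in> fibre r" "x = chords q" "y = chords q1" "y' = chords q2"
      using xy Kf by blast
    obtain a where a: "a \<in> cuts q" "q1 = turn q a" using edge[OF q(1,2)] e q by blast
    obtain b where b: "b \<in> cuts q" "q2 = turn q b" using edge[OF q(1,3)] e q by blast
    have "turn q a = turn q b"
      using less rk q a b by (intro lower_flip_unique[OF fib(1)[OF q(1)] a(1) b(1)]) auto
    then show "y = y'" using q a b by simp
  qed
  moreover have "graph_connected K (induced_edges (H_edges n) K)"
    unfolding Kr(1) by (rule graph_connected_component[OF Kr(2)])
  ultimately show "graph_tree K (induced_edges (H_edges n) K)" by (simp add: graph_tree_def)
qed

text \<open>The components partition the symmetric matchings into classes of size
  \<open>n / 2 + 1\<close>; dividing the binomial coefficient by this size gives the Catalan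
  number.\<close>

lemma card_symmetric_components:
  "real (card {K \<in> H_components n. \<exists>M\<in>K. centrally_symmetric M}) = catalan (n div 2)"
proof -
  define C where "C = {K \<in> H_components n. \<exists>M\<in>K. centrally_symmetric M}"
  have fin: "finite {M \<in> matchings n. centrally_symmetric M}"
    using card_symmetric_matchings zero_less_binomial[of "n div 2" n] by (intro card_ge_0_finite) simp
  have card_C: "card K = n div 2 + 1" if "K \<in> C" for K
    using that symmetric_component_properties(3) by (auto simp: C_def)
  have union: "\<Union>C = {M \<in> matchings n. centrally_symmetric M}"
  proof
    show "\<Union>C \<subseteq> {M \<in> matchings n. centrally_symmetric M}"
    proof
      fix M assume "M \<in> \<Union>C"
      then obtain K M' where K: "K \<in> H_components n" "M \<in> K" "M' \<in> K" "centrally_symmetric M'"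
        by (auto simp: C_def)
      have "M \<in> matchings n"
        using K(1,2) by (auto simp: H_components_def graph_components_def graph_component_def H_verts_def)
      then show "M \<in> {M \<in> matchings n. centrally_symmetric M}"
        using symmetric_component_properties(1)[OF K(1,3,4)] K(2) by blast
    qed
    show "{M \<in> matchings n. centrally_symmetric M} \<subseteq> \<Union>C"
    proof
      fix M assume M: "M \<in> {M \<in> matchings n. centrally_symmetric M}"
      then have "M \<in> graph_component (H_verts n) (H_edges n) M"
        by (intro graph_component_self) (simp add: H_verts_def)
      moreover from this have "graph_component (H_verts n) (H_edges n) M \<in> C"
        using M by (auto simp: C_def H_components_def graph_components_def H_verts_def)
      ultimately show "M \<in> \<Union>C" by blast
    qed
  qed
  have disj: "K \<inter> K' = {}" if "K \<in> C" "K' \<in> C" "K \<noteq> K'" for K K'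
  proof (rule ccontr)
    assume "K \<inter> K' \<noteq> {}"
    then obtain M where "M \<in> K" "M \<in> K'" by blast
    then show False
      using that graph_component_eqI[of M "H_verts n" "H_edges n"]
      by (auto simp: C_def H_components_def graph_components_def)
  qed
  have "finite C" using fin union finite_UnionD by metis
  then have "(n div 2 + 1) * card C = card (\<Union>C)"
    using fin union card_C disj by (intro card_partition) auto
  then have eq: "(n div 2 + 1) * card C = n choose (n div 2)"
    using union card_symmetric_matchings by simp
  have "real ((n div 2 + 1) * card C) = real (n choose (n div 2))" unfolding eq ..
  then have "(real (n div 2) + 1) * real (card C) = real ((2 * (n div 2)) choose (n div 2))"
    using even_n by (simp add: algebra_simps)
  then have "real (card C) = catalan (n div 2)"
    by (simp add: catalan_def field_simps)
  then show ?thesis by (simp only: C_def)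
qed

text \<open>The degree argument needs an asymmetric central face, so it runs on the members
  \<open>A\<close> of the component with that property; antipodal flips show that there is
  one.\<close>

lemma asymmetric_component_not_tree:
  assumes M: "M \<in> matchings n" "\<not> centrally_symmetric M"
    and K: "K = graph_component (H_verts n) (H_edges n) M"
  shows "\<not> graph_tree K (induced_edges (H_edges n) K)"
proof -
  obtain p where p: "lifted_matching p" "chords p = M" using ex_lifted_matching[OF M(1)] .
  then obtain k where "p (k + N) \<noteq> p k + N" using centrally_symmetric_chords_iff M(2) by blast
  then obtain q0 where q0: "(p, q0) \<in> flip_rel\<^sup>*" "lifted_matching q0" "\<not> symmetric_cuts q0"
    using asymmetric_reaches_asymmetric_cuts[OF p(1)] by blast
  have Kp: "K = chords ` {q. (p, q) \<in> flip_rel\<^sup>*}" using component_chords[OF p(1)] p(2) K by simp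
  define A where "A = chords ` {q. (p, q) \<in> flip_rel\<^sup>* \<and> \<not> symmetric_cuts q}"
  have "\<exists>c. graph_cycle K (induced_edges (H_edges n) K) c"
  proof (rule min_degree_two_imp_cycle[of A])
    have "matchings n \<subseteq> Pow (Pow (circle_points n))"
      by (auto simp: matchings_def perfect_matching_def partition_on_def)
    then have "finite (matchings n)" by (rule finite_subset) (simp add: circle_points_def)
    moreover have "K \<subseteq> matchings n" using K by (auto simp: graph_component_def H_verts_def)
    moreover show "A \<subseteq> K" by (auto simp: A_def Kp)
    ultimately show "finite A" by (meson finite_subset)
    show "A \<noteq> {}" using q0 by (auto simp: A_def)
    fix v assume "v \<in> A"
    then obtain q where q: "v = chords q" "(p, q) \<in> flip_rel\<^sup>*" "\<not> symmetric_cuts q" by (auto simp: A_def)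
    have lmq: "lifted_matching q" using flip_rel_lm[OF q(2) p(1)] .
    obtain u w a c a' c' where uw: "u \<noteq> w" "lifted_matching u" "lifted_matching w" "flips_at q u a c"
      "flips_at q w a' c'" "\<not> symmetric_cuts u" "\<not> symmetric_cuts w"
      using asymmetric_two_flips[OF lmq q(3)] .
    have nb: "chords x \<in> A \<and> chords x \<noteq> v \<and> {v, chords x} \<in> induced_edges (H_edges n) K"
      if x: "lifted_matching x" "flips_at q x b d" "\<not> symmetric_cuts x" for x b d
    proof -
      have rel: "(q, x) \<in> flip_rel" using flip_relI[OF lmq x(1,2)] .
      then have "(p, x) \<in> flip_rel\<^sup>*" using q(2) by (rule rtrancl_into_rtrancl[rotated])
      then have "chords x \<in> A" using x(3) by (auto simp: A_def)
      \<comment> \<open>The flip gives \<open>q b\<close> the partner \<open>d\<close> in place of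
        \<open>b\<close>.\<close>
      moreover have "x \<noteq> q"
        using flips_atD[OF lmq x(1,2)] lm_inv[OF lmq, of b] by auto
      then have "chords x \<noteq> v" using chords_inj[OF x(1) lmq] q(1) by blast
      moreover have "{v, chords x} \<in> H_edges n" using H_edge_iff_flip_rel[OF lmq x(1)] rel q(1) by simp
      ultimately show ?thesis using \<open>A \<subseteq> K\<close> \<open>v \<in> A\<close> by (auto simp: induced_edges_def)
    qed
    show "\<exists>u\<in>A. \<exists>w\<in>A. u \<noteq> w \<and> u \<noteq> v \<and> w \<noteq> v \<and> {v, u} \<in> induced_edges (H_edges n) K
        \<and> {v, w} \<in> induced_edges (H_edges n) K"
      using nb[OF uw(2,4,6)] nb[OF uw(3,5,7)] chords_inj[OF uw(2,3)] uw(1)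
      by (intro bexI[of _ "chords u"] bexI[of _ "chords w"]) auto
  qed
  then show ?thesis by (simp add: graph_tree_def)
qed

end

theorem theorem9:
  fixes n :: nat
  assumes "n \<ge> 2" and "even n"
  shows "card {M \<in> matchings n. centrally_symmetric M} = n choose (n div 2)
    \<and> (\<forall>K \<in> H_components n. (\<exists>M\<in>K. centrally_symmetric M) \<longrightarrow>
          (\<forall>M\<in>K. centrally_symmetric M)
        \<and> graph_tree K (induced_edges (H_edges n) K)
        \<and> card K = n div 2 + 1)
    \<and> real (card {K \<in> H_components n. \<exists>M\<in>K. centrally_symmetric M}) = catalan (n div 2)
    \<and> (\<forall>M \<in> matchings n. \<not> centrally_symmetric M \<longrightarrow>
          (let K = graph_component (H_verts n) (H_edges n) M
           in \<not> graph_tree K (induced_edges (H_edges n) K)))"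
proof -
  interpret even_circle n using assms by unfold_locales
  have "\<forall>K \<in> H_components n. (\<exists>M\<in>K. centrally_symmetric M) \<longrightarrow>
      (\<forall>M\<in>K. centrally_symmetric M) \<and> graph_tree K (induced_edges (H_edges n) K) \<and> card K = n div 2 + 1"
    using symmetric_component_properties by blast
  moreover have "\<forall>M \<in> matchings n. \<not> centrally_symmetric M \<longrightarrow>
      (let K = graph_component (H_verts n) (H_edges n) M in \<not> graph_tree K (induced_edges (H_edges n) K))"
    unfolding Let_def using asymmetric_component_not_tree by blast
  ultimately show ?thesis
    using card_symmetric_matchings card_symmetric_components by (intro conjI)
qed

end
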